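(* Let $K\ge 1$ and $N\ge 2K$ be integers, $\rho>1$, $0<\gamma<2\pi$, and $\theta_s=\gamma s/N$ for $s=1,\dots,N$ (circular limited-view setting), with the matrices $\mathbf{C},\mathbf{D}$ and the operator $\mathbf{L}(\mathbf{M})=\mathbf{C}\mathbf{D}\mathbf{M}\mathbf{D}\mathbf{C}^\top$ as defined in the context. Suppose that $\mathbf{C}$ is of maximal rank. For $n=1,\dots,2K$ let $\mu_n$ be the $n$-th largest eigenvalue of the matrix $\mathbf{D}\mathbf{C}^\top\mathbf{C}\mathbf{D}$ and let $v_n$ be the associated orthonormal eigenvectors. Then, for $a,b=1,\dots,2K$, the $(a,b)$-th singular value of the operator $\mathbf{L}$ is $\lambda_{ab}=\sqrt{\mu_a\mu_b}$, with the associated right singular vector the matrix $\mathbf{g}_{ab}=v_av_b^\top$. In particular, the condition number of the operator $\mathbf{L}$ satisfies $$\mathrm{cond}(\mathbf{L})=\mathrm{cond}(\mathbf{D}\mathbf{C}^\top\mathbf{C}\mathbf{D})\le \mathrm{cond}(\mathbf{C})^2\,K^2\rho^{2(K-1)},$$ where $\mathrm{cond}(\mathbf{C})$ is the condition number of the matrix $\mathbf{C}$.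
   Context: $\mathbf{C}$ is the real $N\times 2K$ matrix made of $1\times 2$ blocks $\mathbf{C}_{rm}=(\cos m\theta_r,\ \sin m\theta_r)$, $r=1,\dots,N$, $m=1,\dots,K$. $\mathbf{D}$ is the $2K\times 2K$ block-diagonal matrix $\mathbf{D}=\frac{1}{2\pi}\,\mathrm{diag}\big(\mathbf{I}_2/\rho,\ \mathbf{I}_2/(2\rho^2),\ \dots,\ \mathbf{I}_2/(K\rho^K)\big)$, where $\mathbf{I}_2$ is the $2\times 2$ identity matrix. The operator $\mathbf{L}:\mathbb{R}^{2K\times 2K}\to\mathbb{R}^{N\times N}$ is $\mathbf{L}(\mathbf{M})=\mathbf{C}\mathbf{D}\mathbf{M}\mathbf{D}\mathbf{C}^\top$; matrix spaces carry the termwise (Frobenius) inner product. Eigenvalues are counted with multiplicity and $(v_n)_{n=1}^{2K}$ is an orthonormal basis of real eigenvectors. Singular values of $\mathbf{L}$ are indexed by pairs $(a,b)$ (no ordering by size is implied): the right singular vectors $\mathbf{g}_{ab}\in\mathbb{R}^{2K\times 2K}$ are orthonormal, and the matrices $\mathbf{L}(\mathbf{g}_{ab})$ are mutually orthogonal with Frobenius norm $\lambda_{ab}$. The condition number is the ratio of the largest to the smallest singular value. *)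

theory Defs
  imports
    "Jordan_Normal_Form.DL_Rank"
    "Jordan_Normal_Form.Char_Poly"
begin

definition orthonormal_basis ::
  "'a set \<Rightarrow> ('a \<Rightarrow> 'a \<Rightarrow> real) \<Rightarrow> 'i set \<Rightarrow> ('i \<Rightarrow> 'a) \<Rightarrow> bool" where
  "orthonormal_basis V ip I g \<longleftrightarrow>
     finite I \<and> g ` I \<subseteq> V \<and>
     (\<forall>i\<in>I. \<forall>j\<in>I. ip (g i) (g j) = (if i = j then 1 else 0)) \<and>
     (\<forall>x\<in>V. (\<forall>i\<in>I. ip (g i) x = 0) \<longrightarrow> ip x x = 0)"

text \<open>A system of right singular vectors \<open>g i\<close> of a linear map \<open>T\<close> on \<open>V\<close>, with singular values
  \<open>s i\<close>, for the inner products \<open>ipV\<close> and \<open>ipW\<close> on domain and codomain.  One value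
  is listed for each dimension of \<open>V\<close>, which is the usual convention when the dimension of
  \<open>V\<close> does not exceed that of the codomain.\<close>

definition singular_system ::
  "'a set \<Rightarrow> ('a \<Rightarrow> 'a \<Rightarrow> real) \<Rightarrow> ('b \<Rightarrow> 'b \<Rightarrow> real) \<Rightarrow> ('a \<Rightarrow> 'b) \<Rightarrow>
   'i set \<Rightarrow> ('i \<Rightarrow> 'a) \<Rightarrow> ('i \<Rightarrow> real) \<Rightarrow> bool" where
  "singular_system V ipV ipW T I g s \<longleftrightarrow>
     orthonormal_basis V ipV I g \<and>
     (\<forall>i\<in>I. \<forall>j\<in>I. i \<noteq> j \<longrightarrow> ipW (T (g i)) (T (g j)) = 0) \<and>
     (\<forall>i\<in>I. s i = sqrt (ipW (T (g i)) (T (g i))))"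

definition singular_values ::
  "'a set \<Rightarrow> ('a \<Rightarrow> 'a \<Rightarrow> real) \<Rightarrow> ('b \<Rightarrow> 'b \<Rightarrow> real) \<Rightarrow> ('a \<Rightarrow> 'b) \<Rightarrow> real set" where
  "singular_values V ipV ipW T =
     {s i | (I :: nat set) g s i. singular_system V ipV ipW T I g s \<and> i \<in> I}"

text \<open>The quotient has its usual meaning only when the smallest singular value is nonzero.\<close>

definition condition_number ::
  "'a set \<Rightarrow> ('a \<Rightarrow> 'a \<Rightarrow> real) \<Rightarrow> ('b \<Rightarrow> 'b \<Rightarrow> real) \<Rightarrow> ('a \<Rightarrow> 'b) \<Rightarrow> real" where
  "condition_number V ipV ipW T =
     Max (singular_values V ipV ipW T) / Min (singular_values V ipV ipW T)"

definition frob_inner :: "real mat \<Rightarrow> real mat \<Rightarrow> real" where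
  "frob_inner A B = (\<Sum>i<dim_row A. \<Sum>j<dim_col A. A $$ (i, j) * B $$ (i, j))"

definition mat_cond :: "real mat \<Rightarrow> real" where
  "mat_cond A = condition_number (carrier_vec (dim_col A)) scalar_prod scalar_prod (\<lambda>x. A *\<^sub>v x)"

definition op_cond :: "nat \<Rightarrow> (real mat \<Rightarrow> real mat) \<Rightarrow> real" where
  "op_cond n T = condition_number (carrier_mat n n) frob_inner frob_inner T"

definition maximal_rank :: "real mat \<Rightarrow> bool" where
  "maximal_rank A \<longleftrightarrow> vec_space.rank (dim_row A) A = min (dim_row A) (dim_col A)"

text \<open>The \<open>n\<close>-th largest real eigenvalue, \<open>n\<close> counted from 1, with algebraic multiplicity.\<close>

definition nth_largest_eigenvalue :: "real mat \<Rightarrow> nat \<Rightarrow> real" where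
  "nth_largest_eigenvalue A n = rev (sorted_list_of_multiset (proots (char_poly A))) ! (n - 1)"

definition outer_prod :: "real vec \<Rightarrow> real vec \<Rightarrow> real mat" where
  "outer_prod v w = mat (dim_vec v) (dim_vec w) (\<lambda>(i, j). v $ i * w $ j)"

text \<open>Matrix indices start at 0: columns \<open>2 * (m - 1)\<close> and \<open>2 * (m - 1) + 1\<close> form the block
  of frequency \<open>m\<close>, and row \<open>r - 1\<close> belongs to the angle \<open>\<theta> r\<close>.\<close>

definition C_mat :: "nat \<Rightarrow> nat \<Rightarrow> (nat \<Rightarrow> real) \<Rightarrow> real mat" where
  "C_mat N K \<theta> = mat N (2 * K) (\<lambda>(i, j).
     let m = j div 2 + 1 in
     if even j then cos (real m * \<theta> (i + 1)) else sin (real m * \<theta> (i + 1)))"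

definition D_mat :: "nat \<Rightarrow> real \<Rightarrow> real mat" where
  "D_mat K \<rho> = (1 / (2 * pi)) \<cdot>\<^sub>m mat (2 * K) (2 * K) (\<lambda>(i, j).
     let m = j div 2 + 1 in if i = j then 1 / (real m * \<rho> ^ m) else 0)"

definition L_op :: "real mat \<Rightarrow> real mat \<Rightarrow> real mat \<Rightarrow> real mat" where
  "L_op C D M = C * D * M * D * transpose_mat C"

end

theory Submission
  imports Defs
begin

text \<open>Put \<open>A = C D\<close>.  As \<open>D\<close> is symmetric, \<open>G = A\<^sup>T A\<close> and the operator is the conjugation
  \<open>X \<mapsto> A X A\<^sup>T\<close>.  Everything rests on two observations about this operator.

  It maps a rank-one matrix \<open>v w\<^sup>T\<close> to \<open>(A v) (A w)\<^sup>T\<close>, and the Frobenius inner product of two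
  rank-one matrices is the product of the inner products of their factors.  Hence, if the \<open>v i\<close> are
  orthonormal with \<open>A v i\<close> mutually orthogonal of squared length \<open>m i\<close>, the matrices
  \<open>v a (v b)\<^sup>T\<close> are orthonormal and have mutually orthogonal images of squared length
  \<open>m a * m b\<close> (\<open>outer_prod_singular_system\<close>).  Eigenvectors of \<open>G\<close> have this property with
  \<open>m = \<mu>\<close>, because \<open>v \<bullet> G w = A v \<bullet> A w\<close>.

  For the condition numbers, let \<open>s i\<close> be the singular values of \<open>A\<close>.  Those of \<open>G\<close> are
  the \<open>(s i)\<^sup>2\<close> and those of the operator are the products \<open>s a * s b\<close>, so both condition
  numbers are the square of that of \<open>A\<close> (\<open>mat_cond_gram\<close>, \<open>conjugation_cond\<close>).  The diagonal
  entries of \<open>D\<close> lie between \<open>1 / (2 \<pi> K \<rho>^K)\<close> and \<open>1 / (2 \<pi> \<rho>)\<close>, hence multiplication by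
  \<open>D\<close> increases the condition number of \<open>C\<close> by a factor of at most \<open>K \<rho>^(K-1)\<close>
  (\<open>mat_cond_mult_le\<close>); the full rank of \<open>C\<close> keeps the denominators positive.

  A condition number is defined from the set of the values of all singular systems.  To
  evaluate it, two general facts are needed: a singular system exists
  (\<open>singular_system_exists\<close>), and any one of them already lists all singular values
  (\<open>singular_values_eq\<close>).  They are proved once, in coordinates, for vectors and for matrices.\<close>

section \<open>Bounded sequences in finitely many coordinates\<close>

text \<open>The Bolzano--Weierstrass theorem in \<open>\<real>\<^sup>S\<close>: subsequences are extracted one coordinate at
  a time.  It supplies the compactness of the unit sphere.\<close>

lemma bounded_coordinates_convergent_subseq:
  fixes X :: "nat \<Rightarrow> 'k \<Rightarrow> real"
  assumes "finite S" and "\<And>n k. k \<in> S \<Longrightarrow> \<bar>X n k\<bar> \<le> b"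
  shows "\<exists>r l. strict_mono r \<and> (\<forall>k\<in>S. (\<lambda>n. X (r n) k) \<longlonglongrightarrow> l k)"
  using assms
proof (induction S rule: finite_induct)
  case empty
  show ?case by (intro exI[of _ id]) (auto simp: strict_mono_def)
next
  case (insert k S)
  then obtain r l where r: "strict_mono r" and l: "\<forall>k\<in>S. (\<lambda>n. X (r n) k) \<longlonglongrightarrow> l k"
    by auto
  obtain r' where r': "strict_mono r'" and mono: "monoseq (\<lambda>n. X (r (r' n)) k)"
    using seq_monosub[of "\<lambda>n. X (r n) k"] by auto
  have "Bseq (\<lambda>n. X (r (r' n)) k)"
    by (rule BseqI'[of _ b]) (use insert.prems in auto)
  then obtain z where z: "(\<lambda>n. X (r (r' n)) k) \<longlonglongrightarrow> z"
    using Bseq_monoseq_convergent[OF _ mono] by (auto simp: convergent_def)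
  have "(\<lambda>n. X ((r \<circ> r') n) j) \<longlonglongrightarrow> (l(k := z)) j" if "j \<in> insert k S" for j
  proof (cases "j = k")
    case True
    then show ?thesis using z by simp
  next
    case False
    with that l have "(\<lambda>n. X (r n) j) \<longlonglongrightarrow> l j" by simp
    from LIMSEQ_subseq_LIMSEQ[OF this r'] False show ?thesis by (simp add: o_def)
  qed
  with strict_mono_o[OF r r'] show ?case by blast
qed

section \<open>Singular systems in coordinates\<close>

text \<open>A linear map \<open>T\<close> between Euclidean spaces, seen through coordinates.  The map \<open>c\<close> sends
  \<open>V\<close> onto \<open>\<real>\<^sup>S\<close>, \<open>a\<close> is the matrix of \<open>T\<close>, and its codomain enters only through the form
  \<open>ipW (T x) (T y)\<close>.  Linear combinations are expressed by \<open>realise\<close> in the coordinates instead of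
  by operations on \<open>V\<close>; in this way vectors and matrices of any size, which are carrier sets in a
  type, are treated alike.\<close>

locale coordinate_operator =
  fixes V :: "'a set" and ip :: "'a \<Rightarrow> 'a \<Rightarrow> real" and ipW :: "'b \<Rightarrow> 'b \<Rightarrow> real"
    and T :: "'a \<Rightarrow> 'b" and S :: "'k set" and c :: "'a \<Rightarrow> 'k \<Rightarrow> real"
    and R :: "'r set" and a :: "'r \<Rightarrow> 'k \<Rightarrow> real"
  assumes finite_S: "finite S"
    and realise: "\<exists>x\<in>V. \<forall>k\<in>S. c x k = f k"
    and ip_coords: "x \<in> V \<Longrightarrow> y \<in> V \<Longrightarrow> ip x y = (\<Sum>k\<in>S. c x k * c y k)"
    and form_coords: "x \<in> V \<Longrightarrow> y \<in> V \<Longrightarrow>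
      ipW (T x) (T y) = (\<Sum>r\<in>R. (\<Sum>k\<in>S. a r k * c x k) * (\<Sum>k\<in>S. a r k * c y k))"
begin

lemma ip_commute: "x \<in> V \<Longrightarrow> y \<in> V \<Longrightarrow> ip x y = ip y x"
  by (simp add: ip_coords mult.commute)

lemma ip_nonneg: "x \<in> V \<Longrightarrow> 0 \<le> ip x x"
  by (simp add: ip_coords sum_nonneg)

lemma form_commute: "x \<in> V \<Longrightarrow> y \<in> V \<Longrightarrow> ipW (T x) (T y) = ipW (T y) (T x)"
  by (simp add: form_coords mult.commute)

lemma form_nonneg: "x \<in> V \<Longrightarrow> 0 \<le> ipW (T x) (T x)"
  by (simp add: form_coords sum_nonneg)

lemma ip_self_eq_0: "x \<in> V \<Longrightarrow> ip x x = 0 \<Longrightarrow> k \<in> S \<Longrightarrow> c x k = 0"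
  using finite_S by (simp add: ip_coords sum_nonneg_eq_0_iff)

text \<open>Both \<open>ip x\<close> and \<open>\<lambda>y. ipW (T x) (T y)\<close> are linear functionals of the coordinates, and so
  respect linear combinations taken coordinatewise.\<close>

lemma combination_functional:
  assumes "\<And>y. y \<in> V \<Longrightarrow> \<phi> y = (\<Sum>k\<in>S. m k * c y k)"
    and "z \<in> V" and "\<And>i. i \<in> I \<Longrightarrow> g i \<in> V"
    and "\<And>k. k \<in> S \<Longrightarrow> c z k = (\<Sum>i\<in>I. \<alpha> i * c (g i) k)"
  shows "\<phi> z = (\<Sum>i\<in>I. \<alpha> i * \<phi> (g i))"
proof -
  have "\<phi> z = (\<Sum>k\<in>S. \<Sum>i\<in>I. \<alpha> i * (m k * c (g i) k))"
    unfolding assms(1)[OF assms(2)]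
    by (rule sum.cong) (auto simp: assms(4) sum_distrib_left algebra_simps)
  also have "\<dots> = (\<Sum>i\<in>I. \<alpha> i * (\<Sum>k\<in>S. m k * c (g i) k))"
    by (subst sum.swap) (simp add: sum_distrib_left)
  also have "\<dots> = (\<Sum>i\<in>I. \<alpha> i * \<phi> (g i))"
    by (rule sum.cong) (auto simp: assms(1,3))
  finally show ?thesis .
qed

lemma combination_ip:
  assumes "x \<in> V" "z \<in> V" "\<And>i. i \<in> I \<Longrightarrow> g i \<in> V"
    and "\<And>k. k \<in> S \<Longrightarrow> c z k = (\<Sum>i\<in>I. \<alpha> i * c (g i) k)"
  shows "ip x z = (\<Sum>i\<in>I. \<alpha> i * ip x (g i))"
  by (rule combination_functional[where m = "c x", OF _ assms(2-4)])
    (auto simp: ip_coords assms(1))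

lemma combination_form:
  assumes "x \<in> V" "z \<in> V" "\<And>i. i \<in> I \<Longrightarrow> g i \<in> V"
    and "\<And>k. k \<in> S \<Longrightarrow> c z k = (\<Sum>i\<in>I. \<alpha> i * c (g i) k)"
  shows "ipW (T x) (T z) = (\<Sum>i\<in>I. \<alpha> i * ipW (T x) (T (g i)))"
proof (rule combination_functional[where \<phi> = "\<lambda>y. ipW (T x) (T y)"
      and m = "\<lambda>k. \<Sum>r\<in>R. (\<Sum>k'\<in>S. a r k' * c x k') * a r k", OF _ assms(2-4)])
  fix y assume "y \<in> V"
  then have "ipW (T x) (T y) = (\<Sum>r\<in>R. \<Sum>k\<in>S. (\<Sum>k'\<in>S. a r k' * c x k') * a r k * c y k)"
    by (simp add: form_coords assms(1) sum_distrib_left algebra_simps)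
  also have "\<dots> = (\<Sum>k\<in>S. (\<Sum>r\<in>R. (\<Sum>k'\<in>S. a r k' * c x k') * a r k) * c y k)"
    by (subst sum.swap) (simp add: sum_distrib_right)
  finally show "ipW (T x) (T y) = (\<Sum>k\<in>S. (\<Sum>r\<in>R. (\<Sum>k'\<in>S. a r k' * c x k') * a r k) * c y k)" .
qed auto

lemma obtain_pair_combination:
  assumes "x \<in> V" "y \<in> V"
  obtains z where "z \<in> V"
    "\<And>w. w \<in> V \<Longrightarrow> ip w z = s * ip w x + t * ip w y"
    "\<And>w. w \<in> V \<Longrightarrow> ipW (T w) (T z) = s * ipW (T w) (T x) + t * ipW (T w) (T y)"
proof -
  obtain z where z: "z \<in> V" "\<forall>k\<in>S. c z k = s * c x k + t * c y k"
    using realise[of "\<lambda>k. s * c x k + t * c y k"] by auto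
  let ?g = "\<lambda>b. if b then x else y" and ?\<alpha> = "\<lambda>b. if b then s else t"
  have g: "?g b \<in> V" for b using assms by simp
  have comb: "c z k = (\<Sum>b\<in>UNIV. ?\<alpha> b * c (?g b) k)" if "k \<in> S" for k
    using z that by (simp add: UNIV_bool)
  show thesis
  proof (rule that[OF z(1)])
    fix w assume w: "w \<in> V"
    show "ip w z = s * ip w x + t * ip w y"
      using combination_ip[OF w z(1) g comb] by (simp add: UNIV_bool)
    show "ipW (T w) (T z) = s * ipW (T w) (T x) + t * ipW (T w) (T y)"
      using combination_form[OF w z(1) g comb] by (simp add: UNIV_bool)
  qed
qed

text \<open>The difference between \<open>x\<close> and its Fourier sum is orthogonal to the basis, hence has norm
  zero by completeness, hence zero coordinates.\<close>

lemma basis_expansion: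
  assumes b: "orthonormal_basis V ip I g" and x: "x \<in> V" and k: "k \<in> S"
  shows "c x k = (\<Sum>i\<in>I. ip (g i) x * c (g i) k)"
proof -
  have fin: "finite I" and gV: "\<And>i. i \<in> I \<Longrightarrow> g i \<in> V"
    and on: "\<And>i j. i \<in> I \<Longrightarrow> j \<in> I \<Longrightarrow> ip (g i) (g j) = (if i = j then 1 else 0)"
    and complete: "\<And>y. y \<in> V \<Longrightarrow> (\<forall>i\<in>I. ip (g i) y = 0) \<Longrightarrow> ip y y = 0"
    using b unfolding orthonormal_basis_def by auto
  obtain z where z: "z \<in> V" "\<forall>k\<in>S. c z k = (\<Sum>i\<in>I. ip (g i) x * c (g i) k)"
    using realise[of "\<lambda>k. \<Sum>i\<in>I. ip (g i) x * c (g i) k"] by auto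
  have gz: "ip (g j) z = ip (g j) x" if j: "j \<in> I" for j
  proof -
    have "ip (g j) z = (\<Sum>i\<in>I. ip (g i) x * ip (g j) (g i))"
      by (rule combination_ip) (use z gV j in auto)
    also have "\<dots> = (\<Sum>i\<in>I. if i = j then ip (g i) x else 0)"
      by (rule sum.cong) (auto simp: on j)
    finally show ?thesis using fin j by simp
  qed
  obtain y where y: "y \<in> V" "\<forall>k\<in>S. c y k = c x k - c z k"
    using realise[of "\<lambda>k. c x k - c z k"] by auto
  have "ip (g j) y = 0" if j: "j \<in> I" for j
  proof -
    have "ip (g j) y = ip (g j) x - ip (g j) z"
      using y z(1) x gV[OF j]
      by (simp add: ip_coords right_diff_distrib sum_subtractf del: eq_diff_eq)
    then show ?thesis using gz[OF j] by simp
  qed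
  then have "ip y y = 0" using complete y(1) by blast
  then have "c y k = 0" using ip_self_eq_0 y(1) k by blast
  then show ?thesis using y(2) z(2) k by simp
qed

lemma parseval:
  assumes b: "orthonormal_basis V ip I g" and x: "x \<in> V" and y: "y \<in> V"
  shows "ip y x = (\<Sum>i\<in>I. ip (g i) x * ip y (g i))"
    and "ipW (T y) (T x) = (\<Sum>i\<in>I. ip (g i) x * ipW (T y) (T (g i)))"
proof -
  have gV: "\<And>i. i \<in> I \<Longrightarrow> g i \<in> V" using b unfolding orthonormal_basis_def by auto
  note e = basis_expansion[OF b x]
  show "ip y x = (\<Sum>i\<in>I. ip (g i) x * ip y (g i))"
    by (rule combination_ip[OF y x gV e])
  show "ipW (T y) (T x) = (\<Sum>i\<in>I. ip (g i) x * ipW (T y) (T (g i)))"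
    by (rule combination_form[OF y x gV e])
qed

context
  fixes I :: "'i set" and g s
  assumes sys: "singular_system V ip ipW T I g s"
begin

lemma sys_basis: "orthonormal_basis V ip I g"
  using sys unfolding singular_system_def by blast

lemma sys_finite: "finite I"
  using sys_basis unfolding orthonormal_basis_def by blast

lemma sys_carrier: "i \<in> I \<Longrightarrow> g i \<in> V"
  using sys_basis unfolding orthonormal_basis_def by auto

lemma sys_value_nonneg: "i \<in> I \<Longrightarrow> 0 \<le> s i"
  using sys sys_carrier form_nonneg unfolding singular_system_def by simp

lemma sys_form: "i \<in> I \<Longrightarrow> j \<in> I \<Longrightarrow> ipW (T (g i)) (T (g j)) = (if i = j then (s i)\<^sup>2 else 0)"
  using sys sys_carrier form_nonneg unfolding singular_system_def by simp

text \<open>A right singular vector is an eigenvector of \<open>T\<^sup>* T\<close>: this is that eigenvalue equation in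
  weak form, which needs no adjoint.\<close>

lemma form_with_singular_vector:
  assumes "i \<in> I" "x \<in> V"
  shows "ipW (T (g i)) (T x) = (s i)\<^sup>2 * ip (g i) x"
proof -
  have "ipW (T (g i)) (T x) = (\<Sum>j\<in>I. ip (g j) x * ipW (T (g i)) (T (g j)))"
    using parseval(2)[OF sys_basis assms(2) sys_carrier[OF assms(1)]] .
  also have "\<dots> = (\<Sum>j\<in>I. if j = i then (s i)\<^sup>2 * ip (g i) x else 0)"
    by (rule sum.cong) (auto simp: sys_form assms(1))
  finally show ?thesis using sys_finite assms(1) by simp
qed

lemma form_self_expansion:
  assumes x: "x \<in> V"
  shows "ipW (T x) (T x) = (\<Sum>i\<in>I. (s i)\<^sup>2 * (ip (g i) x)\<^sup>2)"
    and "ip x x = (\<Sum>i\<in>I. (ip (g i) x)\<^sup>2)"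
proof -
  have "ipW (T x) (T x) = (\<Sum>i\<in>I. ip (g i) x * ipW (T x) (T (g i)))"
    using parseval(2)[OF sys_basis x x] .
  also have "\<dots> = (\<Sum>i\<in>I. (s i)\<^sup>2 * (ip (g i) x)\<^sup>2)"
    by (rule sum.cong)
      (auto simp: form_commute[OF x sys_carrier] form_with_singular_vector x power2_eq_square)
  finally show "ipW (T x) (T x) = (\<Sum>i\<in>I. (s i)\<^sup>2 * (ip (g i) x)\<^sup>2)" .
  have "ip x x = (\<Sum>i\<in>I. ip (g i) x * ip x (g i))"
    using parseval(1)[OF sys_basis x x] .
  also have "\<dots> = (\<Sum>i\<in>I. (ip (g i) x)\<^sup>2)"
    by (rule sum.cong) (auto simp: ip_commute[OF x sys_carrier] power2_eq_square)
  finally show "ip x x = (\<Sum>i\<in>I. (ip (g i) x)\<^sup>2)" .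
qed

lemma form_between_extreme_values:
  assumes x: "x \<in> V"
  shows "ipW (T x) (T x) \<le> (Max (s ` I))\<^sup>2 * ip x x"
    and "I \<noteq> {} \<Longrightarrow> (Min (s ` I))\<^sup>2 * ip x x \<le> ipW (T x) (T x)"
proof -
  have "(s i)\<^sup>2 \<le> (Max (s ` I))\<^sup>2" if "i \<in> I" for i
    using that sys_finite sys_value_nonneg by (intro power_mono) auto
  then show "ipW (T x) (T x) \<le> (Max (s ` I))\<^sup>2 * ip x x"
    unfolding form_self_expansion[OF x] sum_distrib_left
    by (intro sum_mono mult_right_mono) auto
  assume ne: "I \<noteq> {}"
  have "(Min (s ` I))\<^sup>2 \<le> (s i)\<^sup>2" if "i \<in> I" for i
    using that sys_finite sys_value_nonneg ne by (intro power_mono) auto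
  then show "(Min (s ` I))\<^sup>2 * ip x x \<le> ipW (T x) (T x)"
    unfolding form_self_expansion[OF x] sum_distrib_left
    by (intro sum_mono mult_right_mono) auto
qed

text \<open>Expand \<open>ipW (T (g i)) (T (h j))\<close> in either system: it equals both
  \<open>(s i)\<^sup>2 * ip (g i) (h j)\<close> and \<open>(t j)\<^sup>2 * ip (g i) (h j)\<close>.  By completeness of \<open>g\<close> some
  \<open>g i\<close> is not orthogonal to \<open>h j\<close>, and for this \<open>i\<close> the values agree.\<close>

lemma value_in_other_system:
  assumes sys': "singular_system V ip ipW T J h t" and j: "j \<in> J"
  shows "t j \<in> s ` I"
proof -
  have h: "h j \<in> V" "ip (h j) (h j) = 1" and tj: "t j = sqrt (ipW (T (h j)) (T (h j)))"
    using sys' j unfolding singular_system_def orthonormal_basis_def by auto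
  have "\<exists>i\<in>I. ip (g i) (h j) \<noteq> 0"
    using h sys_basis unfolding orthonormal_basis_def by fastforce
  then obtain i where i: "i \<in> I" and ne: "ip (g i) (h j) \<noteq> 0" by blast
  have "(s i)\<^sup>2 * ip (g i) (h j) = ipW (T (g i)) (T (h j))"
    using form_with_singular_vector[OF i h(1)] by simp
  also have "\<dots> = ipW (T (h j)) (T (g i))"
    using form_commute h(1) sys_carrier i by blast
  also have "\<dots> = (t j)\<^sup>2 * ip (h j) (g i)"
    using h form_nonneg coordinate_operator.form_with_singular_vector
      [OF coordinate_operator_axioms sys' j sys_carrier[OF i]] by simp
  also have "ip (h j) (g i) = ip (g i) (h j)"
    using ip_commute h(1) sys_carrier i by blast
  finally have "(s i)\<^sup>2 = (t j)\<^sup>2" using ne by simp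
  moreover have "0 \<le> s i" using sys_value_nonneg i by blast
  moreover have "0 \<le> t j" using tj form_nonneg h by simp
  ultimately have "t j = s i" by (metis power2_eq_imp_eq)
  then show ?thesis using i by (rule image_eqI)
qed

lemma singular_values_eq: "singular_values V ip ipW T = s ` I"
proof
  show "singular_values V ip ipW T \<subseteq> s ` I"
    unfolding singular_values_def by (auto dest: value_in_other_system)
  \<comment> \<open>Singular values are collected over systems indexed by natural numbers, so \<open>I\<close> is renumbered.\<close>
  obtain f where f: "bij_betw f {0..<card I} I"
    using ex_bij_betw_nat_finite[OF sys_finite] by blast
  then have inj: "f i = f j \<longleftrightarrow> i = j" if "i < card I" "j < card I" for i j
    using that by (auto simp: bij_betw_def inj_on_def)
  have surj: "\<exists>j<card I. i = f j" if "i \<in> I" for i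
    using f that unfolding bij_betw_def by (metis atLeastLessThan_iff imageE)
  have fI: "f i \<in> I" if "i < card I" for i using f that by (auto simp: bij_betw_def)
  have complete: "ip x x = 0" if "x \<in> V" "\<forall>i\<in>{0..<card I}. ip (g (f i)) x = 0" for x
  proof -
    have "\<forall>i\<in>I. ip (g i) x = 0" using that(2) surj by fastforce
    then show ?thesis using sys_basis that(1) unfolding orthonormal_basis_def by blast
  qed
  have "orthonormal_basis V ip {0..<card I} (g \<circ> f)"
    unfolding orthonormal_basis_def
  proof (intro conjI ballI impI)
    show "(g \<circ> f) ` {0..<card I} \<subseteq> V" using fI sys_carrier by auto
    fix i j assume "i \<in> {0..<card I}" "j \<in> {0..<card I}"
    then show "ip ((g \<circ> f) i) ((g \<circ> f) j) = (if i = j then 1 else 0)"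
      using sys_basis fI inj unfolding orthonormal_basis_def by auto
  qed (use complete in auto)
  moreover have "s i = sqrt (ipW (T (g i)) (T (g i)))" if "i \<in> I" for i
    using sys that unfolding singular_system_def by blast
  ultimately have sys': "singular_system V ip ipW T {0..<card I} (g \<circ> f) (s \<circ> f)"
    unfolding singular_system_def using fI inj sys_form by simp
  show "s ` I \<subseteq> singular_values V ip ipW T"
  proof
    fix x assume "x \<in> s ` I"
    then obtain i where "i \<in> {0..<card I}" "x = (s \<circ> f) i" using surj by fastforce
    then show "x \<in> singular_values V ip ipW T"
      unfolding singular_values_def
      by (intro CollectI exI[of _ "{0..<card I}"] exI[of _ "g \<circ> f"] exI[of _ "s \<circ> f"]
          exI[of _ i]) (use sys' in auto)
  qed
qed

lemma condition_number_eq: "condition_number V ip ipW T = Max (s ` I) / Min (s ` I)"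
  unfolding condition_number_def singular_values_eq ..

lemma sys_nonempty:
  assumes "S \<noteq> {}"
  shows "I \<noteq> {}"
proof
  assume "I = {}"
  obtain x where x: "x \<in> V" "\<forall>k\<in>S. c x k = 1" using realise[of "\<lambda>_. 1"] by auto
  have "ip x x = 0" using form_self_expansion(2)[OF x(1)] \<open>I = {}\<close> by simp
  then show False using ip_self_eq_0[OF x(1)] x(2) assms by force
qed

end

lemma form_bounded_on_sphere:
  assumes x: "x \<in> V" and unit: "ip x x = 1"
  shows "k \<in> S \<Longrightarrow> \<bar>c x k\<bar> \<le> 1"
    and "ipW (T x) (T x) \<le> (\<Sum>r\<in>R. (\<Sum>k\<in>S. \<bar>a r k\<bar>)\<^sup>2)"
proof -
  have c: "\<bar>c x k\<bar> \<le> 1" if "k \<in> S" for k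
  proof -
    have "(c x k)\<^sup>2 \<le> (\<Sum>k\<in>S. (c x k)\<^sup>2)"
      by (rule member_le_sum) (use that finite_S in auto)
    also have "\<dots> = 1" using unit x by (simp add: ip_coords power2_eq_square)
    finally show ?thesis by (simp add: abs_square_le_1)
  qed
  then show "k \<in> S \<Longrightarrow> \<bar>c x k\<bar> \<le> 1" .
  have "(\<Sum>k\<in>S. a r k * c x k)\<^sup>2 \<le> (\<Sum>k\<in>S. \<bar>a r k\<bar>)\<^sup>2" for r
  proof -
    have "\<bar>\<Sum>k\<in>S. a r k * c x k\<bar> \<le> (\<Sum>k\<in>S. \<bar>a r k * c x k\<bar>)" by (rule sum_abs)
    also have "\<dots> \<le> (\<Sum>k\<in>S. \<bar>a r k\<bar>)"
      by (rule sum_mono) (use c in \<open>auto simp: abs_mult mult_left_le\<close>)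
    finally have "\<bar>\<Sum>k\<in>S. a r k * c x k\<bar> \<le> \<bar>\<Sum>k\<in>S. \<bar>a r k\<bar>\<bar>" by simp
    then show ?thesis by (rule abs_le_square_iff[THEN iffD1])
  qed
  then show "ipW (T x) (T x) \<le> (\<Sum>r\<in>R. (\<Sum>k\<in>S. \<bar>a r k\<bar>)\<^sup>2)"
    unfolding form_coords[OF x x] power2_eq_square by (rule sum_mono)
qed

text \<open>A maximising sequence on the unit sphere of the orthogonal complement of the \<open>g i\<close> has a
  coordinatewise convergent subsequence, and constraints and form are continuous in the
  coordinates.  The maximum is stated for all \<open>y\<close> in the complement, scaled by \<open>ip y y\<close>.\<close>

lemma form_attains_max_on_complement:
  assumes g: "\<And>i. i \<in> I \<Longrightarrow> g i \<in> V"
    and ne: "x0 \<in> V" "\<And>i. i \<in> I \<Longrightarrow> ip (g i) x0 = 0" "ip x0 x0 \<noteq> 0"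
  obtains u where "u \<in> V" "\<And>i. i \<in> I \<Longrightarrow> ip (g i) u = 0" "ip u u = 1"
    and "\<And>y. y \<in> V \<Longrightarrow> (\<And>i. i \<in> I \<Longrightarrow> ip (g i) y = 0) \<Longrightarrow>
           ipW (T y) (T y) \<le> ipW (T u) (T u) * ip y y"
proof -
  define F where "F = {x \<in> V. (\<forall>i\<in>I. ip (g i) x = 0) \<and> ip x x = 1}"
  define Q where "Q = (\<lambda>x. ipW (T x) (T x))"
  have normalise: "\<exists>z\<in>F. Q z * ip y y = Q y"
    if y: "y \<in> V" "\<And>i. i \<in> I \<Longrightarrow> ip (g i) y = 0" "ip y y \<noteq> 0" for y
  proof -
    define t where "t = 1 / sqrt (ip y y)"
    have pos: "ip y y > 0" using y ip_nonneg[OF y(1)] by simp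
    obtain z where z: "z \<in> V" "\<And>w. w \<in> V \<Longrightarrow> ip w z = t * ip w y + 0 * ip w y"
      "\<And>w. w \<in> V \<Longrightarrow> ipW (T w) (T z) = t * ipW (T w) (T y) + 0 * ipW (T w) (T y)"
      using obtain_pair_combination[OF y(1) y(1)] by blast
    have tt: "t * t * ip y y = 1" using pos by (simp add: t_def)
    have "ip z z = t * t * ip y y"
      using z(2)[OF z(1)] z(2)[OF y(1)] ip_commute[OF z(1) y(1)] by simp
    moreover have "Q z = t * t * Q y"
      using z(3)[OF z(1)] z(3)[OF y(1)] form_commute[OF z(1) y(1)] by (simp add: Q_def)
    ultimately have "z \<in> F" "Q z * ip y y = (t * t * ip y y) * Q y"
      using z y(2) g tt by (auto simp: F_def)
    then show ?thesis using tt by auto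
  qed
  obtain z0 where z0: "z0 \<in> F" using normalise[OF ne] by blast
  have bdd: "bdd_above (Q ` F)"
    unfolding bdd_above_def
    by (rule exI[of _ "\<Sum>r\<in>R. (\<Sum>k\<in>S. \<bar>a r k\<bar>)\<^sup>2"])
      (auto simp: F_def Q_def form_bounded_on_sphere(2))
  define m where "m = Sup (Q ` F)"
  have le_m: "Q x \<le> m" if "x \<in> F" for x
    unfolding m_def using that bdd by (auto intro: cSup_upper)
  have "\<exists>x\<in>F. m - inverse (real (Suc n)) < Q x" for n
  proof -
    have "m - inverse (real (Suc n)) < Sup (Q ` F)" by (simp add: m_def)
    then show ?thesis using less_cSup_iff[OF _ bdd] z0 by blast
  qed
  then obtain X where X: "\<And>n. X n \<in> F" and QX: "\<And>n. m - inverse (real (Suc n)) < Q (X n)"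
    by metis
  have XV: "X n \<in> V" for n using X by (auto simp: F_def)
  have "\<bar>c (X n) k\<bar> \<le> 1" if "k \<in> S" for n k
    using form_bounded_on_sphere(1)[of "X n" k] X[of n] that by (simp add: F_def)
  then obtain r l where r: "strict_mono r"
    and l: "\<forall>k\<in>S. (\<lambda>n. c (X (r n)) k) \<longlonglongrightarrow> l k"
    using bounded_coordinates_convergent_subseq[OF finite_S, of "\<lambda>n k. c (X n) k" 1] by auto
  obtain u where u: "u \<in> V" "\<forall>k\<in>S. c u k = l k" using realise[of l] by auto
  have lim: "(\<lambda>n. c (X (r n)) k) \<longlonglongrightarrow> c u k" if "k \<in> S" for k
    using that l u by simp
  have lim_ip: "(\<lambda>n. ip w (X (r n))) \<longlonglongrightarrow> ip w u" if "w \<in> V" for w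
    unfolding ip_coords[OF that XV] ip_coords[OF that u(1)] by (intro tendsto_intros lim)
  have lim_self: "(\<lambda>n. ip (X (r n)) (X (r n))) \<longlonglongrightarrow> ip u u"
    unfolding ip_coords[OF XV XV] ip_coords[OF u(1) u(1)] by (intro tendsto_intros lim)
  have lim_Q: "(\<lambda>n. Q (X (r n))) \<longlonglongrightarrow> Q u"
    unfolding Q_def form_coords[OF XV XV] form_coords[OF u(1) u(1)]
    by (intro tendsto_intros lim)
  have orth: "ip (g i) u = 0" if "i \<in> I" for i
    using lim_ip[OF g[OF that]] X that LIMSEQ_unique[OF _ tendsto_const] by (simp add: F_def)
  have unit: "ip u u = 1"
    using lim_self X LIMSEQ_unique[OF _ tendsto_const] by (simp add: F_def)
  have "(\<lambda>n. m - inverse (real (Suc (r n)))) \<longlonglongrightarrow> m - 0"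
    by (intro tendsto_intros LIMSEQ_subseq_LIMSEQ[OF LIMSEQ_inverse_real_of_nat r, unfolded o_def])
  then have "m \<le> Q u"
    using LIMSEQ_le[OF _ lim_Q, of "\<lambda>n. m - inverse (real (Suc (r n)))" m] QX
    by (auto intro: less_imp_le)
  show thesis
  proof (rule that[OF u(1) orth unit])
    fix y assume y: "y \<in> V" "\<And>i. i \<in> I \<Longrightarrow> ip (g i) y = 0"
    show "ipW (T y) (T y) \<le> ipW (T u) (T u) * ip y y"
    proof (cases "ip y y = 0")
      case True
      then have "c y k = 0" if "k \<in> S" for k using ip_self_eq_0 y(1) that by blast
      then show ?thesis using True by (simp add: form_coords[OF y(1) y(1)])
    next
      case False
      then obtain z where z: "z \<in> F" "Q z * ip y y = Q y" using normalise[OF y] by blast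
      have "Q z \<le> Q u" using le_m[OF z(1)] \<open>m \<le> Q u\<close> by simp
      then have "Q z * ip y y \<le> Q u * ip y y" by (rule mult_right_mono) (rule ip_nonneg[OF y(1)])
      then show ?thesis using z(2) by (simp add: Q_def)
    qed
  qed
qed

text \<open>Perturb the maximiser to \<open>u + t y\<close>.  The inequality becomes \<open>2 t b \<le> t\<^sup>2 q\<close> for all \<open>t\<close>,
  with \<open>b = ipW (T u) (T y)\<close>, and this forces \<open>b = 0\<close>.  The premise \<open>max\<close> asks for maximality
  only at those \<open>z\<close> that satisfy every orthogonality relation satisfied by both \<open>u\<close> and \<open>y\<close>, as
  all \<open>u + t y\<close> do.\<close>

lemma maximiser_stationary:
  assumes u: "u \<in> V" "ip u u = 1" and y: "y \<in> V" "ip u y = 0"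
    and max: "\<And>z. z \<in> V \<Longrightarrow> (\<And>w. w \<in> V \<Longrightarrow> ip w u = 0 \<Longrightarrow> ip w y = 0 \<Longrightarrow> ip w z = 0) \<Longrightarrow>
      ipW (T z) (T z) \<le> ipW (T u) (T u) * ip z z"
  shows "ipW (T u) (T y) = 0"
proof -
  define b where "b = ipW (T u) (T y)"
  define q where "q = ipW (T u) (T u) * ip y y - ipW (T y) (T y)"
  have quad: "2 * t * b \<le> t\<^sup>2 * q" for t
  proof -
    obtain z where z: "z \<in> V" "\<And>w. w \<in> V \<Longrightarrow> ip w z = 1 * ip w u + t * ip w y"
      "\<And>w. w \<in> V \<Longrightarrow> ipW (T w) (T z) = 1 * ipW (T w) (T u) + t * ipW (T w) (T y)"
      using obtain_pair_combination[OF u(1) y(1)] by blast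
    have zz: "ip z z = 1 + t\<^sup>2 * ip y y"
      using z(2)[OF z(1)] z(2)[OF u(1)] z(2)[OF y(1)] ip_commute[OF z(1) u(1)]
        ip_commute[OF z(1) y(1)] ip_commute[OF y(1) u(1)] u(2) y(2)
      by (simp add: power2_eq_square)
    have Qz: "ipW (T z) (T z) = ipW (T u) (T u) + 2 * t * b + t\<^sup>2 * ipW (T y) (T y)"
      using z(3)[OF z(1)] z(3)[OF u(1)] z(3)[OF y(1)] form_commute[OF z(1) u(1)]
        form_commute[OF z(1) y(1)] form_commute[OF y(1) u(1)]
      by (simp add: b_def power2_eq_square algebra_simps)
    have "ipW (T z) (T z) \<le> ipW (T u) (T u) * ip z z"
      by (rule max[OF z(1)]) (simp add: z(2))
    then show ?thesis unfolding zz Qz by (simp add: q_def algebra_simps)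
  qed
  define D where "D = \<bar>q\<bar> + 1"
  have D: "D > 0" "q \<le> D" unfolding D_def by auto
  \<comment> \<open>A small step in the direction of \<open>b\<close>: dividing by \<open>D > \<bar>q\<bar>\<close> makes the linear term win.\<close>
  have "2 * (b / D) * b \<le> (b / D)\<^sup>2 * q" by (rule quad)
  also have "\<dots> \<le> (b / D)\<^sup>2 * D" using D by (intro mult_left_mono) auto
  finally have "2 * (b * b) / D \<le> b * b / D" using D by (simp add: power2_eq_square)
  then have "b * b \<le> 0" using D by (simp add: divide_le_cancel)
  then show ?thesis unfolding b_def[symmetric] by (metis mult_le_0_iff order_antisym)
qed

text \<open>Sum Bessel's inequality for the coordinate unit vectors over \<open>S\<close>: the total squared length of
  the family is \<open>n\<close>, and every coordinate contributes at most 1.\<close>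

lemma orthonormal_family_card_le:
  assumes g: "\<And>i. i < n \<Longrightarrow> g i \<in> V"
    and on: "\<And>i j. i < n \<Longrightarrow> j < n \<Longrightarrow> ip (g i) (g j) = (if i = j then 1 else 0)"
  shows "n \<le> card S"
proof -
  \<comment> \<open>Here \<open>z\<close> is the projection of the unit vector \<open>e\<close>, so \<open>ip z z = ip z e\<close>, which is the
    coordinate \<open>c z k\<close>.\<close>
  have bessel: "(\<Sum>i<n. (c (g i) k)\<^sup>2) \<le> 1" if k: "k \<in> S" for k
  proof -
    obtain e where e: "e \<in> V" "\<forall>j\<in>S. c e j = (if j = k then 1 else 0)"
      using realise[of "\<lambda>j. if j = k then 1 else 0"] by auto
    have eV: "ip x e = c x k" if "x \<in> V" for x
    proof -
      have "ip x e = (\<Sum>j\<in>S. if j = k then c x j else 0)"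
        unfolding ip_coords[OF that e(1)] by (rule sum.cong) (use e in auto)
      then show ?thesis using k finite_S by simp
    qed
    obtain z where z: "z \<in> V" "\<forall>j\<in>S. c z j = (\<Sum>i<n. c (g i) k * c (g i) j)"
      using realise[of "\<lambda>j. \<Sum>i<n. c (g i) k * c (g i) j"] by auto
    have ipz: "ip w z = (\<Sum>i<n. c (g i) k * ip w (g i))" if "w \<in> V" for w
      by (rule combination_ip) (use that z g in auto)
    have gz: "ip (g j) z = c (g j) k" if "j < n" for j
    proof -
      have "ip (g j) z = (\<Sum>i<n. if i = j then c (g i) k else 0)"
        unfolding ipz[OF g[OF that]] by (rule sum.cong) (use on that in auto)
      then show ?thesis using that by simp
    qed
    have "ip z z = (\<Sum>i<n. (c (g i) k)\<^sup>2)"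
      unfolding ipz[OF z(1)]
      by (rule sum.cong) (use gz g z(1) ip_commute in \<open>auto simp: power2_eq_square\<close>)
    moreover have "c z k = (\<Sum>i<n. (c (g i) k)\<^sup>2)"
      using z(2) k by (simp add: power2_eq_square)
    ultimately have zz: "ip z z = c z k" by simp
    have "(c z k)\<^sup>2 \<le> (\<Sum>j\<in>S. (c z j)\<^sup>2)"
      by (rule member_le_sum) (use k finite_S in auto)
    also have "\<dots> = c z k" using zz z(1) by (simp add: ip_coords power2_eq_square)
    finally have "c z k \<le> 1"
      by (metis linorder_not_le mult_le_cancel_right2 not_one_le_zero order_trans power2_eq_square linear)
    then show ?thesis using z(2) k by (simp add: power2_eq_square)
  qed
  have "real n = (\<Sum>i<n. ip (g i) (g i))" by (simp add: on)
  also have "\<dots> = (\<Sum>k\<in>S. \<Sum>i<n. (c (g i) k)\<^sup>2)"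
    by (subst sum.swap) (simp add: ip_coords g power2_eq_square)
  also have "\<dots> \<le> real (card S)" using sum_mono[of S, OF bessel] by simp
  finally show ?thesis by simp
qed

text \<open>Singular vectors are chosen greedily, each maximising the form on the unit sphere orthogonal
  to the earlier ones.  The invariant \<open>P n\<close> records orthonormality together with stationarity:
  the image of \<open>g i\<close> is orthogonal to the image of everything orthogonal to \<open>g 0, \<dots>, g i\<close>; this
  gives the orthogonality of the images.  The length is bounded by the dimension, and a family
  of maximal length is complete, since otherwise one more maximiser would extend it.\<close>

lemma singular_system_exists:
  "\<exists>n g s. singular_system V ip ipW T {..<n::nat} g s"
proof -
  define P where "P n \<longleftrightarrow> (\<exists>g. (\<forall>i<n. g i \<in> V) \<and>
      (\<forall>i<n. \<forall>j<n. ip (g i) (g j) = (if i = j then 1 else 0)) \<and>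
      (\<forall>i<n. \<forall>y\<in>V. (\<forall>j\<le>i. ip (g j) y = 0) \<longrightarrow> ipW (T (g i)) (T y) = 0))" for n :: nat
  have "P 0" by (simp add: P_def)
  have bound: "n \<le> card S" if "P n" for n
    using that orthonormal_family_card_le unfolding P_def by (metis (no_types, lifting))
  define n where "n = (GREATEST n. P n)"
  have Pn: "P n"
    unfolding n_def using GreatestI_nat[of P 0 "card S"] \<open>P 0\<close> bound by blast
  have notP: "\<not> P (Suc n)"
    using Greatest_le_nat[of P "Suc n" "card S"] bound by (auto simp: n_def)
  obtain g where gV: "\<And>i. i < n \<Longrightarrow> g i \<in> V"
    and on: "\<And>i j. i < n \<Longrightarrow> j < n \<Longrightarrow> ip (g i) (g j) = (if i = j then 1 else 0)"
    and stat: "\<And>i y. i < n \<Longrightarrow> y \<in> V \<Longrightarrow> (\<forall>j\<le>i. ip (g j) y = 0) \<Longrightarrow> ipW (T (g i)) (T y) = 0"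
    using Pn unfolding P_def by metis
  have complete: "ip x x = 0" if x: "x \<in> V" "\<forall>i\<in>{..<n}. ip (g i) x = 0" for x
  proof (rule ccontr)
    assume "ip x x \<noteq> 0"
    then obtain u where u: "u \<in> V" "\<And>i. i \<in> {..<n} \<Longrightarrow> ip (g i) u = 0" "ip u u = 1"
      and max: "\<And>y. y \<in> V \<Longrightarrow> (\<And>i. i \<in> {..<n} \<Longrightarrow> ip (g i) y = 0) \<Longrightarrow>
        ipW (T y) (T y) \<le> ipW (T u) (T u) * ip y y"
      using form_attains_max_on_complement[of "{..<n}" g x] gV x by (metis lessThan_iff)
    let ?g = "g(n := u)"
    have "P (Suc n)"
      unfolding P_def
    proof (intro exI[of _ ?g] conjI allI impI ballI)
      show "?g i \<in> V" if "i < Suc n" for i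
        using that gV u(1) by (auto simp: less_Suc_eq)
      show "ip (?g i) (?g j) = (if i = j then 1 else 0)" if "i < Suc n" "j < Suc n" for i j
      proof -
        have "ip u (g j) = 0" if "j < n" for j
          using u(2)[of j] ip_commute[OF u(1) gV[OF that]] that by simp
        then show ?thesis
          using that on[of i j] u(2)[of i] u(3) by (cases "i = n"; cases "j = n") auto
      qed
      show "ipW (T (?g i)) (T y) = 0"
        if i: "i < Suc n" and y: "y \<in> V" "\<forall>j\<le>i. ip (?g j) y = 0" for i y
      proof (cases "i = n")
        case False
        then have "i < n" using i by simp
        moreover have "\<forall>j\<le>i. ip (g j) y = 0"
          using y(2) \<open>i < n\<close> by (metis fun_upd_apply leD)
        ultimately show ?thesis using stat y(1) by auto
      next
        case True
        have uy: "ip u y = 0" using y(2) True by auto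
        have gy: "ip (g j) y = 0" if "j < n" for j
          using y(2)[rule_format, of j] that True by auto
        have "ipW (T u) (T y) = 0"
          by (rule maximiser_stationary[OF u(1,3) y(1) uy], rule max) (use u(2) gV gy in auto)
        then show ?thesis using True by simp
      qed
    qed
    with notP show False by simp
  qed
  have "ipW (T (g i)) (T (g j)) = 0" if "i < n" "j < n" "i \<noteq> j" for i j
  proof -
    have *: "ipW (T (g i)) (T (g j)) = 0" if "i < j" "j < n" for i j
      by (rule stat) (use that gV on in auto)
    show ?thesis
      using * that form_commute[OF gV gV] by (metis linorder_neqE_nat)
  qed
  then have "singular_system V ip ipW T {..<n} g (\<lambda>i. sqrt (ipW (T (g i)) (T (g i))))"
    unfolding singular_system_def orthonormal_basis_def
    using gV on complete by auto
  then show ?thesis by blast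
qed

end

section \<open>Real matrices and the conjugation operator\<close>

lemma coordinate_operator_mat:
  fixes A :: "real mat"
  assumes A: "A \<in> carrier_mat nr nc"
  shows "coordinate_operator (carrier_vec nc) scalar_prod scalar_prod (\<lambda>x. A *\<^sub>v x)
    {..<nc} vec_index {..<nr} (\<lambda>r k. A $$ (r, k))"
proof
  show "\<exists>x\<in>carrier_vec nc. \<forall>k\<in>{..<nc}. x $ k = f k" for f :: "nat \<Rightarrow> real"
    by (rule bexI[of _ "vec nc f"]) auto
  show "x \<bullet> y = (\<Sum>k<nc. x $ k * y $ k)" if "x \<in> carrier_vec nc" "y \<in> carrier_vec nc"
    for x y :: "real vec"
    using that by (auto simp: scalar_prod_def atLeast0LessThan)
  show "(A *\<^sub>v x) \<bullet> (A *\<^sub>v y) =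
      (\<Sum>r<nr. (\<Sum>k<nc. A $$ (r, k) * x $ k) * (\<Sum>k<nc. A $$ (r, k) * y $ k))"
    if "x \<in> carrier_vec nc" "y \<in> carrier_vec nc" for x y :: "real vec"
    using that A by (auto simp: scalar_prod_def atLeast0LessThan intro!: sum.cong)
qed simp

lemma frob_inner_carrier:
  "X \<in> carrier_mat nr nc \<Longrightarrow>
    frob_inner X Y = (\<Sum>(i, j)\<in>{..<nr} \<times> {..<nc}. X $$ (i, j) * Y $$ (i, j))"
  by (auto simp: frob_inner_def sum.cartesian_product)

lemma index_conjugation:
  fixes A :: "real mat"
  assumes A: "A \<in> carrier_mat nr nc" and X: "X \<in> carrier_mat nc nc" and ij: "i < nr" "j < nr"
  shows "(A * X * transpose_mat A) $$ (i, j) =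
    (\<Sum>(k, l)\<in>{..<nc} \<times> {..<nc}. A $$ (i, k) * A $$ (j, l) * X $$ (k, l))"
proof -
  have "(A * X * transpose_mat A) $$ (i, j) =
      (\<Sum>l<nc. (\<Sum>k<nc. A $$ (i, k) * X $$ (k, l)) * A $$ (j, l))"
    using A X ij
    by (auto simp: scalar_prod_def atLeast0LessThan simp del: assoc_mult_mat intro!: sum.cong)
  also have "\<dots> = (\<Sum>k<nc. \<Sum>l<nc. A $$ (i, k) * A $$ (j, l) * X $$ (k, l))"
    by (subst sum.swap) (simp add: sum_distrib_left sum_distrib_right algebra_simps)
  finally show ?thesis by (simp add: sum.cartesian_product)
qed

lemma coordinate_operator_conjugation:
  fixes A :: "real mat"
  assumes A: "A \<in> carrier_mat nr nc"
  shows "coordinate_operator (carrier_mat nc nc) frob_inner frob_inner (\<lambda>X. A * X * transpose_mat A)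
    ({..<nc} \<times> {..<nc}) (\<lambda>X p. X $$ p) ({..<nr} \<times> {..<nr})
    (\<lambda>(i, j) (k, l). A $$ (i, k) * A $$ (j, l))"
proof
  show "\<exists>x\<in>carrier_mat nc nc. \<forall>k\<in>{..<nc} \<times> {..<nc}. x $$ k = f k" for f :: "nat \<times> nat \<Rightarrow> real"
    by (rule bexI[of _ "mat nc nc f"]) auto
  show "frob_inner X Y = (\<Sum>k\<in>{..<nc} \<times> {..<nc}. X $$ k * Y $$ k)"
    if "X \<in> carrier_mat nc nc" for X Y
    unfolding frob_inner_carrier[OF that] by (rule sum.cong) auto
  fix X Y :: "real mat" assume X: "X \<in> carrier_mat nc nc" and Y: "Y \<in> carrier_mat nc nc"
  have AX: "A * X * transpose_mat A \<in> carrier_mat nr nr" using A X by auto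
  show "frob_inner (A * X * transpose_mat A) (A * Y * transpose_mat A) =
      (\<Sum>r\<in>{..<nr} \<times> {..<nr}.
        (\<Sum>k\<in>{..<nc} \<times> {..<nc}. (case r of (i, j) \<Rightarrow> \<lambda>(k, l). A $$ (i, k) * A $$ (j, l)) k * X $$ k) *
        (\<Sum>k\<in>{..<nc} \<times> {..<nc}. (case r of (i, j) \<Rightarrow> \<lambda>(k, l). A $$ (i, k) * A $$ (j, l)) k * Y $$ k))"
    unfolding frob_inner_carrier[OF AX]
    by (rule sum.cong)
      (auto simp: index_conjugation[OF A X] index_conjugation[OF A Y] case_prod_unfold
        simp del: index_mult_mat)
qed simp

text \<open>A singular system depends on the operator only through its values on \<open>V\<close>; \<open>L_op\<close> is the
  conjugation operator only on matrices of the right size.\<close>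

lemma singular_system_cong:
  assumes "\<And>x. x \<in> V \<Longrightarrow> T x = T' x"
  shows "singular_system V ipV ipW T I g s \<longleftrightarrow> singular_system V ipV ipW T' I g s"
proof (cases "g ` I \<subseteq> V")
  case True
  then have "T (g i) = T' (g i)" if "i \<in> I" for i using assms that by blast
  then show ?thesis unfolding singular_system_def by simp
next
  case False
  then show ?thesis unfolding singular_system_def orthonormal_basis_def by simp
qed

lemma condition_number_cong:
  assumes "\<And>x. x \<in> V \<Longrightarrow> T x = T' x"
  shows "condition_number V ipV ipW T = condition_number V ipV ipW T'"
  unfolding condition_number_def singular_values_def
  by (simp add: singular_system_cong[of V T T', OF assms])

lemma frob_inner_outer_prod:
  assumes "dim_vec v = dim_vec v'" "dim_vec w = dim_vec w'"
  shows "frob_inner (outer_prod v w) (outer_prod v' w') = (v \<bullet> v') * (w \<bullet> w')"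
proof -
  have "frob_inner (outer_prod v w) (outer_prod v' w') =
      (\<Sum>i<dim_vec v. \<Sum>j<dim_vec w. (v $ i * v' $ i) * (w $ j * w' $ j))"
    unfolding frob_inner_def by (intro sum.cong) (use assms in \<open>auto simp: outer_prod_def\<close>)
  then show ?thesis using assms by (simp add: scalar_prod_def atLeast0LessThan sum_product)
qed

lemma conjugation_outer_prod:
  fixes A :: "real mat"
  assumes A: "A \<in> carrier_mat nr nc" and v: "v \<in> carrier_vec nc" and w: "w \<in> carrier_vec nc"
  shows "A * outer_prod v w * transpose_mat A = outer_prod (A *\<^sub>v v) (A *\<^sub>v w)"
proof (rule eq_matI)
  have X: "outer_prod v w \<in> carrier_mat nc nc" using v w by (simp add: outer_prod_def)
  fix i j
  assume "i < dim_row (outer_prod (A *\<^sub>v v) (A *\<^sub>v w))" "j < dim_col (outer_prod (A *\<^sub>v v) (A *\<^sub>v w))"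
  then have ij: "i < nr" "j < nr" using A by (auto simp: outer_prod_def)
  have "(A * outer_prod v w * transpose_mat A) $$ (i, j) =
      (\<Sum>k<nc. \<Sum>l<nc. A $$ (i, k) * A $$ (j, l) * outer_prod v w $$ (k, l))"
    unfolding index_conjugation[OF A X ij] by (simp add: sum.cartesian_product)
  also have "\<dots> = (\<Sum>k<nc. \<Sum>l<nc. (A $$ (i, k) * v $ k) * (A $$ (j, l) * w $ l))"
    by (intro sum.cong) (use v w in \<open>auto simp: outer_prod_def\<close>)
  also have "\<dots> = (\<Sum>k<nc. A $$ (i, k) * v $ k) * (\<Sum>l<nc. A $$ (j, l) * w $ l)"
    by (simp add: sum_product)
  also have "\<dots> = outer_prod (A *\<^sub>v v) (A *\<^sub>v w) $$ (i, j)"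
    using A v w ij by (simp add: outer_prod_def scalar_prod_def atLeast0LessThan)
  finally show "(A * outer_prod v w * transpose_mat A) $$ (i, j) =
    outer_prod (A *\<^sub>v v) (A *\<^sub>v w) $$ (i, j)" .
qed (use A in \<open>auto simp: outer_prod_def\<close>)

lemma complete_family_vec:
  fixes v :: "'i \<Rightarrow> real vec"
  assumes "orthonormal_basis (carrier_vec n) scalar_prod I v" "x \<in> carrier_vec n"
    and "\<And>i. i \<in> I \<Longrightarrow> v i \<bullet> x = 0"
  shows "x = 0\<^sub>v n"
proof -
  have "x \<bullet> x = 0" using assms unfolding orthonormal_basis_def by blast
  then have "x $ k = 0" if "k < n" for k
    using that assms(2) by (auto simp: scalar_prod_def sum_nonneg_eq_0_iff)
  then show ?thesis using assms(2) by auto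
qed

lemma scalar_prod_mult_mat_vec:
  fixes A :: "real mat"
  assumes "A \<in> carrier_mat nr nc" "x \<in> carrier_vec nc" "y \<in> carrier_vec nr"
  shows "y \<bullet> (A *\<^sub>v x) = (transpose_mat A *\<^sub>v y) \<bullet> x"
proof -
  have "y \<bullet> (A *\<^sub>v x) = (\<Sum>i<nr. \<Sum>k<nc. A $$ (i, k) * y $ i * x $ k)"
    using assms by (auto simp: scalar_prod_def atLeast0LessThan sum_distrib_left algebra_simps
        intro!: sum.cong)
  also have "\<dots> = (transpose_mat A *\<^sub>v y) \<bullet> x"
    by (subst sum.swap)
      (use assms in \<open>auto simp: scalar_prod_def atLeast0LessThan sum_distrib_right intro!: sum.cong\<close>)
  finally show ?thesis .
qed

lemma gram_form:
  fixes A :: "real mat"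
  assumes A: "A \<in> carrier_mat nr nc" and x: "x \<in> carrier_vec nc" and y: "y \<in> carrier_vec nc"
  shows "x \<bullet> ((transpose_mat A * A) *\<^sub>v y) = (A *\<^sub>v x) \<bullet> (A *\<^sub>v y)"
proof -
  have "(transpose_mat A * A) *\<^sub>v y = transpose_mat A *\<^sub>v (A *\<^sub>v y)"
    using A y by (intro assoc_mult_mat_vec) auto
  then show ?thesis
    using scalar_prod_mult_mat_vec[of "transpose_mat A" nc nr "A *\<^sub>v y" x] A x y by simp
qed

text \<open>Completeness of the rank-one matrices: \<open>X\<close> being orthogonal to \<open>v a (v b)\<^sup>T\<close> means
  \<open>v a \<bullet> X v b = 0\<close>.  Completeness of \<open>v\<close> gives \<open>X v b = 0\<close> for all \<open>b\<close>, and, applied once more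
  to the rows of \<open>X\<close>, it gives \<open>X = 0\<close>.\<close>

lemma outer_prod_singular_system:
  fixes A :: "real mat"
  assumes A: "A \<in> carrier_mat nr nc"
    and v: "orthonormal_basis (carrier_vec nc) scalar_prod I v"
    and Av: "\<And>i j. i \<in> I \<Longrightarrow> j \<in> I \<Longrightarrow> (A *\<^sub>v v i) \<bullet> (A *\<^sub>v v j) = (if i = j then m i else 0)"
  shows "singular_system (carrier_mat nc nc) frob_inner frob_inner (\<lambda>X. A * X * transpose_mat A)
    (I \<times> I) (\<lambda>(a, b). outer_prod (v a) (v b)) (\<lambda>(a, b). sqrt (m a * m b))"
proof -
  have fin: "finite I" and vV: "\<And>i. i \<in> I \<Longrightarrow> v i \<in> carrier_vec nc"
    and on: "\<And>i j. i \<in> I \<Longrightarrow> j \<in> I \<Longrightarrow> v i \<bullet> v j = (if i = j then 1 else 0)"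
    using v unfolding orthonormal_basis_def by auto
  have dim: "dim_vec (v i) = nc" if "i \<in> I" for i using vV[OF that] by simp
  have inner: "frob_inner (outer_prod (v a) (v b)) (outer_prod (v a') (v b')) =
      (if (a, b) = (a', b') then 1 else 0)" if "a \<in> I" "b \<in> I" "a' \<in> I" "b' \<in> I" for a b a' b'
    using that by (simp add: frob_inner_outer_prod dim on)
  have image: "frob_inner (A * outer_prod (v a) (v b) * transpose_mat A)
      (A * outer_prod (v a') (v b') * transpose_mat A) =
      (if (a, b) = (a', b') then m a * m b else 0)"
    if "a \<in> I" "b \<in> I" "a' \<in> I" "b' \<in> I" for a b a' b'
    using that by (simp add: conjugation_outer_prod[OF A] vV frob_inner_outer_prod Av)
  have complete: "frob_inner X X = 0"
    if X: "X \<in> carrier_mat nc nc"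
      and X0: "\<And>a b. a \<in> I \<Longrightarrow> b \<in> I \<Longrightarrow> frob_inner (outer_prod (v a) (v b)) X = 0" for X
  proof -
    have rank1: "frob_inner (outer_prod (v a) (v b)) X = v a \<bullet> (X *\<^sub>v v b)" if "a \<in> I" "b \<in> I" for a b
      using that X vV[of a] vV[of b]
      by (auto simp: frob_inner_def outer_prod_def scalar_prod_def atLeast0LessThan
          sum_distrib_left algebra_simps intro!: sum.cong)
    have Xv: "X *\<^sub>v v b = 0\<^sub>v nc" if "b \<in> I" for b
      by (rule complete_family_vec[OF v]) (use that X vV[OF that] X0 rank1 in auto)
    have row: "row X i = 0\<^sub>v nc" if i: "i < nc" for i
    proof (rule complete_family_vec[OF v])
      show "row X i \<in> carrier_vec nc" using X by auto
      fix b assume b: "b \<in> I"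
      have "row X i \<bullet> v b = (X *\<^sub>v v b) $ i" using X i by simp
      then show "v b \<bullet> row X i = 0"
        using Xv[OF b] i comm_scalar_prod[OF \<open>row X i \<in> carrier_vec nc\<close> vV[OF b]] by simp
    qed
    have "X $$ (i, j) = 0" if "i < nc" "j < nc" for i j
    proof -
      have "X $$ (i, j) = row X i $ j" using X that by simp
      then show ?thesis using row that by simp
    qed
    then show ?thesis using X by (simp add: frob_inner_def)
  qed
  have "orthonormal_basis (carrier_mat nc nc) frob_inner (I \<times> I) (\<lambda>(a, b). outer_prod (v a) (v b))"
    unfolding orthonormal_basis_def
    using fin inner complete by (auto simp: outer_prod_def dim)
  then show ?thesis
    unfolding singular_system_def using image by auto
qed

lemma singular_system_exists_mat:
  fixes A :: "real mat"
  assumes A: "A \<in> carrier_mat nr nc" and "nc \<noteq> 0"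
  obtains n v s where "singular_system (carrier_vec nc) scalar_prod scalar_prod (\<lambda>x. A *\<^sub>v x)
    {..<n::nat} v s" and "n \<noteq> 0"
proof -
  interpret A: coordinate_operator "carrier_vec nc" scalar_prod scalar_prod "\<lambda>x. A *\<^sub>v x"
    "{..<nc}" vec_index "{..<nr}" "\<lambda>r k. A $$ (r, k)"
    by (rule coordinate_operator_mat[OF A])
  obtain n v s where sys: "singular_system (carrier_vec nc) scalar_prod scalar_prod (\<lambda>x. A *\<^sub>v x)
    {..<n::nat} v s" using A.singular_system_exists by blast
  moreover have "n \<noteq> 0" using A.sys_nonempty[OF sys] assms(2) by (auto simp: lessThan_empty_iff)
  ultimately show thesis using that by blast
qed

lemma Max_Min_image_mono:
  fixes f :: "'i \<Rightarrow> real" and h :: "real \<Rightarrow> real"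
  assumes "finite I" "I \<noteq> {}"
    and "\<And>i j. i \<in> I \<Longrightarrow> j \<in> I \<Longrightarrow> f i \<le> f j \<Longrightarrow> g i \<le> g j"
    and "\<And>i. i \<in> I \<Longrightarrow> g i = h (f i)"
  shows "Max (g ` I) = h (Max (f ` I))" "Min (g ` I) = h (Min (f ` I))"
proof -
  have "Max (f ` I) \<in> f ` I" "Min (f ` I) \<in> f ` I" using assms(1,2) by auto
  then obtain i j where i: "i \<in> I" "Max (f ` I) = f i" and j: "j \<in> I" "Min (f ` I) = f j" by auto
  have "Max (g ` I) = g i"
  proof (rule Max_eqI)
    fix y assume "y \<in> g ` I"
    then obtain k where k: "k \<in> I" "y = g k" by blast
    have "f k \<le> f i" unfolding i(2)[symmetric] using assms(1) k(1) by simp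
    then show "y \<le> g i" using assms(3) k i by blast
  qed (use assms(1) i in auto)
  then show "Max (g ` I) = h (Max (f ` I))" using assms(4) i by simp
  have "Min (g ` I) = g j"
  proof (rule Min_eqI)
    fix y assume "y \<in> g ` I"
    then obtain k where k: "k \<in> I" "y = g k" by blast
    have "f j \<le> f k" unfolding j(2)[symmetric] using assms(1) k(1) by simp
    then show "g j \<le> y" using assms(3) k j by blast
  qed (use assms(1) j in auto)
  then show "Min (g ` I) = h (Min (f ` I))" using assms(4) j by simp
qed

text \<open>A singular system of \<open>A\<close> is also one of \<open>A\<^sup>T A\<close>, with the values squared.\<close>

lemma mat_cond_gram:
  fixes A :: "real mat"
  assumes A: "A \<in> carrier_mat nr nc" and nz: "nc \<noteq> 0"
  shows "mat_cond (transpose_mat A * A) = (mat_cond A)\<^sup>2"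
proof -
  interpret A: coordinate_operator "carrier_vec nc" scalar_prod scalar_prod "\<lambda>x. A *\<^sub>v x"
    "{..<nc}" vec_index "{..<nr}" "\<lambda>r k. A $$ (r, k)"
    by (rule coordinate_operator_mat[OF A])
  let ?G = "transpose_mat A * A"
  have G: "?G \<in> carrier_mat nc nc" using A by auto
  interpret G: coordinate_operator "carrier_vec nc" scalar_prod scalar_prod "\<lambda>x. ?G *\<^sub>v x"
    "{..<nc}" vec_index "{..<nc}" "\<lambda>r k. ?G $$ (r, k)"
    by (rule coordinate_operator_mat[OF G])
  obtain n v s where sys: "singular_system (carrier_vec nc) scalar_prod scalar_prod (\<lambda>x. A *\<^sub>v x)
      {..<n::nat} v s" and n: "n \<noteq> 0"
    using singular_system_exists_mat[OF A nz] .
  have vV: "v i \<in> carrier_vec nc" if "i < n" for i using A.sys_carrier[OF sys] that by simp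
  have Gx: "?G *\<^sub>v x \<in> carrier_vec nc" if "x \<in> carrier_vec nc" for x using G that by auto
  have "(?G *\<^sub>v v i) \<bullet> (?G *\<^sub>v v j) = (if i = j then ((s i)\<^sup>2)\<^sup>2 else 0)" if ij: "i < n" "j < n" for i j
  proof -
    have "(?G *\<^sub>v v i) \<bullet> (?G *\<^sub>v v j) = (A *\<^sub>v (?G *\<^sub>v v i)) \<bullet> (A *\<^sub>v v j)"
      by (rule gram_form[OF A Gx[OF vV[OF ij(1)]] vV[OF ij(2)]])
    also have "\<dots> = (A *\<^sub>v v j) \<bullet> (A *\<^sub>v (?G *\<^sub>v v i))"
      using A.form_commute vV Gx ij by blast
    also have "\<dots> = (s j)\<^sup>2 * (v j \<bullet> (?G *\<^sub>v v i))"
      by (rule A.form_with_singular_vector[OF sys]) (use ij vV Gx in auto)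
    also have "v j \<bullet> (?G *\<^sub>v v i) = (if j = i then (s j)\<^sup>2 else 0)"
      using gram_form[OF A] A.sys_form[OF sys] ij vV by simp
    finally show ?thesis by (auto simp: power2_eq_square)
  qed
  then have "singular_system (carrier_vec nc) scalar_prod scalar_prod (\<lambda>x. ?G *\<^sub>v x)
      {..<n} v (\<lambda>i. (s i)\<^sup>2)"
    using A.sys_basis[OF sys] real_sqrt_unique[of "(s i)\<^sup>2" "s i ^ 4" for i]
    unfolding singular_system_def by simp
  then have "mat_cond ?G = Max ((\<lambda>i. (s i)\<^sup>2) ` {..<n}) / Min ((\<lambda>i. (s i)\<^sup>2) ` {..<n})"
    using G.condition_number_eq A by (simp add: mat_cond_def)
  also have "\<dots> = (Max (s ` {..<n}))\<^sup>2 / (Min (s ` {..<n}))\<^sup>2"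
    using Max_Min_image_mono[of "{..<n}" s "\<lambda>i. (s i)\<^sup>2" "\<lambda>x. x\<^sup>2"] n
      A.sys_value_nonneg[OF sys] by (simp add: power_mono lessThan_empty_iff)
  also have "\<dots> = (mat_cond A)\<^sup>2"
    using A.condition_number_eq[OF sys] A by (simp add: mat_cond_def power_divide)
  finally show ?thesis .
qed

lemma Max_Min_image_product:
  fixes s :: "'i \<Rightarrow> real"
  assumes I: "finite I" "I \<noteq> {}" and s: "\<And>i. i \<in> I \<Longrightarrow> 0 \<le> s i"
  shows "Max ((\<lambda>(a, b). s a * s b) ` (I \<times> I)) = (Max (s ` I))\<^sup>2"
    and "Min ((\<lambda>(a, b). s a * s b) ` (I \<times> I)) = (Min (s ` I))\<^sup>2"
proof -
  have "Max (s ` I) \<in> s ` I" "Min (s ` I) \<in> s ` I" using I by auto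
  then obtain i j where i: "i \<in> I" "Max (s ` I) = s i" and j: "j \<in> I" "Min (s ` I) = s j" by auto
  have ij: "s j \<le> s k" "s k \<le> s i" if "k \<in> I" for k
    unfolding i(2)[symmetric] j(2)[symmetric] using I that by auto
  show "Max ((\<lambda>(a, b). s a * s b) ` (I \<times> I)) = (Max (s ` I))\<^sup>2"
    unfolding i(2) power2_eq_square
    by (rule Max_eqI) (use I i ij s in \<open>auto intro!: mult_mono image_eqI[of _ _ "(i, i)"]\<close>)
  show "Min ((\<lambda>(a, b). s a * s b) ` (I \<times> I)) = (Min (s ` I))\<^sup>2"
    unfolding j(2) power2_eq_square
    by (rule Min_eqI) (use I j ij s in \<open>auto intro!: mult_mono image_eqI[of _ _ "(j, j)"]\<close>)
qed

lemma conjugation_cond: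
  fixes A :: "real mat"
  assumes A: "A \<in> carrier_mat nr nc" and nz: "nc \<noteq> 0"
  shows "op_cond nc (\<lambda>X. A * X * transpose_mat A) = (mat_cond A)\<^sup>2"
proof -
  interpret A: coordinate_operator "carrier_vec nc" scalar_prod scalar_prod "\<lambda>x. A *\<^sub>v x"
    "{..<nc}" vec_index "{..<nr}" "\<lambda>r k. A $$ (r, k)"
    by (rule coordinate_operator_mat[OF A])
  interpret L: coordinate_operator "carrier_mat nc nc" frob_inner frob_inner
    "\<lambda>X. A * X * transpose_mat A" "{..<nc} \<times> {..<nc}" "\<lambda>X p. X $$ p" "{..<nr} \<times> {..<nr}"
    "\<lambda>(i, j) (k, l). A $$ (i, k) * A $$ (j, l)"
    by (rule coordinate_operator_conjugation[OF A])
  obtain n v s where sys: "singular_system (carrier_vec nc) scalar_prod scalar_prod (\<lambda>x. A *\<^sub>v x)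
      {..<n::nat} v s" and n: "n \<noteq> 0"
    using singular_system_exists_mat[OF A nz] .
  have nonneg: "0 \<le> s i" if "i \<in> {..<n}" for i using A.sys_value_nonneg[OF sys that] .
  have "singular_system (carrier_mat nc nc) frob_inner frob_inner (\<lambda>X. A * X * transpose_mat A)
    ({..<n} \<times> {..<n}) (\<lambda>(a, b). outer_prod (v a) (v b)) (\<lambda>(a, b). sqrt ((s a)\<^sup>2 * (s b)\<^sup>2))"
    by (rule outer_prod_singular_system[OF A A.sys_basis[OF sys]]) (rule A.sys_form[OF sys])
  from L.condition_number_eq[OF this]
  have "op_cond nc (\<lambda>X. A * X * transpose_mat A) =
      Max ((\<lambda>(a, b). sqrt ((s a)\<^sup>2 * (s b)\<^sup>2)) ` ({..<n} \<times> {..<n})) /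
      Min ((\<lambda>(a, b). sqrt ((s a)\<^sup>2 * (s b)\<^sup>2)) ` ({..<n} \<times> {..<n}))"
    by (simp add: op_cond_def)
  also have "(\<lambda>(a, b). sqrt ((s a)\<^sup>2 * (s b)\<^sup>2)) ` ({..<n} \<times> {..<n}) =
      (\<lambda>(a, b). s a * s b) ` ({..<n} \<times> {..<n})"
    by (rule image_cong) (use nonneg in \<open>auto simp: real_sqrt_mult\<close>)
  also have "Max \<dots> / Min \<dots> = (Max (s ` {..<n}))\<^sup>2 / (Min (s ` {..<n}))\<^sup>2"
    using Max_Min_image_product[of "{..<n}" s] nonneg n by (simp add: lessThan_empty_iff)
  also have "\<dots> = (mat_cond A)\<^sup>2"
    using A.condition_number_eq[OF sys] A by (simp add: mat_cond_def power_divide)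
  finally show ?thesis .
qed

text \<open>Repeated columns would leave fewer than \<open>nc\<close> distinct ones, too few for the rank; so the
  columns are distinct and independent, and a nonzero kernel vector would be a dependence.\<close>

lemma full_column_rank_injective:
  fixes A :: "real mat"
  assumes A: "A \<in> carrier_mat nr nc" and rank: "vec_space.rank nr A = nc"
    and x: "x \<in> carrier_vec nc" "A *\<^sub>v x = 0\<^sub>v nr"
  shows "x = 0\<^sub>v nc"
proof (rule ccontr)
  interpret vec_space "TYPE(real)" nr .
  assume "x \<noteq> 0\<^sub>v nc"
  obtain B where B: "maximal B (\<lambda>T. T \<subseteq> set (cols A) \<and> lin_indpt T)"
    using maximal_exists[of "\<lambda>T. T \<subseteq> set (cols A) \<and> lin_indpt T" "card (set (cols A))" "{}"]
    by (meson List.finite_set card_mono empty_iff empty_subsetI finite_lin_indpt2 rev_finite_subset)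
  then have "rank A = card B" using rank_card_indpt[OF A] by blast
  also have "\<dots> \<le> card (set (cols A))" using B by (simp add: card_mono maximal_def)
  finally have "length (cols A) \<le> card (set (cols A))" using A rank by simp
  then have dist: "distinct (cols A)" by (metis card_distinct card_length le_antisym)
  then have "lin_indpt (set (cols A))" using full_rank_lin_indpt[OF A rank] by blast
  then show False using lin_depI[OF A x(1) \<open>x \<noteq> 0\<^sub>v nc\<close> x(2) dist] by blast
qed

text \<open>Evaluated at a unit singular vector \<open>w\<close> of \<open>A D\<close>, the singular value is the length of
  \<open>A (D w)\<close>.  It lies between \<open>a * p\<close> and \<open>b * q\<close>, where \<open>a\<close> and \<open>b\<close> are the extreme singular
  values of \<open>A\<close>; injectivity makes \<open>a\<close> positive.\<close>

lemma mat_cond_mult_le: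
  fixes A D :: "real mat"
  assumes A: "A \<in> carrier_mat nr nc" and D: "D \<in> carrier_mat nc nc" and nz: "nc \<noteq> 0"
    and inj: "\<And>x. x \<in> carrier_vec nc \<Longrightarrow> A *\<^sub>v x = 0\<^sub>v nr \<Longrightarrow> x = 0\<^sub>v nc"
    and p: "0 < p" "\<And>x. x \<in> carrier_vec nc \<Longrightarrow> p\<^sup>2 * (x \<bullet> x) \<le> (D *\<^sub>v x) \<bullet> (D *\<^sub>v x)"
    and q: "0 \<le> q" "\<And>x. x \<in> carrier_vec nc \<Longrightarrow> (D *\<^sub>v x) \<bullet> (D *\<^sub>v x) \<le> q\<^sup>2 * (x \<bullet> x)"
  shows "0 \<le> mat_cond (A * D)" and "mat_cond (A * D) \<le> mat_cond A * (q / p)"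
proof -
  interpret A: coordinate_operator "carrier_vec nc" scalar_prod scalar_prod "\<lambda>x. A *\<^sub>v x"
    "{..<nc}" vec_index "{..<nr}" "\<lambda>r k. A $$ (r, k)"
    by (rule coordinate_operator_mat[OF A])
  have AD: "A * D \<in> carrier_mat nr nc" using A D by auto
  interpret AD: coordinate_operator "carrier_vec nc" scalar_prod scalar_prod "\<lambda>x. (A * D) *\<^sub>v x"
    "{..<nc}" vec_index "{..<nr}" "\<lambda>r k. (A * D) $$ (r, k)"
    by (rule coordinate_operator_mat[OF AD])
  obtain n v s where sys: "singular_system (carrier_vec nc) scalar_prod scalar_prod (\<lambda>x. A *\<^sub>v x)
      {..<n::nat} v s" and n: "n \<noteq> 0"
    using singular_system_exists_mat[OF A nz] .
  obtain n' w t where sys': "singular_system (carrier_vec nc) scalar_prod scalar_prod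
      (\<lambda>x. (A * D) *\<^sub>v x) {..<n'::nat} w t" and n': "n' \<noteq> 0"
    using singular_system_exists_mat[OF AD nz] .
  define a b where "a = Min (s ` {..<n})" and "b = Max (s ` {..<n})"
  have ne: "{..<n} \<noteq> {}" "{..<n'} \<noteq> {}" using n n' by (auto simp: lessThan_empty_iff)
  have "0 < s i" if i: "i < n" for i
  proof -
    have vi: "v i \<in> carrier_vec nc" "v i \<bullet> v i = 1"
      using A.sys_basis[OF sys] i unfolding orthonormal_basis_def by auto
    have "s i \<noteq> 0"
    proof
      assume "s i = 0"
      then have "(A *\<^sub>v v i) \<bullet> (A *\<^sub>v v i) = 0" using A.sys_form[OF sys] i by simp
      then have "(A *\<^sub>v v i) $ k = 0" if "k < nr" for k
        using that A by (auto simp: scalar_prod_def sum_nonneg_eq_0_iff)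
      then have "A *\<^sub>v v i = 0\<^sub>v nr" using A by auto
      then show False using inj vi by force
    qed
    then show ?thesis using A.sys_value_nonneg[OF sys] i by fastforce
  qed
  then have a: "0 < a" unfolding a_def using ne(1) by simp
  have "a \<le> b" unfolding a_def b_def using ne(1) by (intro Min_le_iff[THEN iffD2]) auto
  have t: "a * p \<le> t i" "t i \<le> b * q" if i: "i < n'" for i
  proof -
    have wi: "w i \<in> carrier_vec nc" "w i \<bullet> w i = 1"
      using AD.sys_basis[OF sys'] i unfolding orthonormal_basis_def by auto
    have Dw: "D *\<^sub>v w i \<in> carrier_vec nc" using D wi by auto
    have "(t i)\<^sup>2 = ((A * D) *\<^sub>v w i) \<bullet> ((A * D) *\<^sub>v w i)" using AD.sys_form[OF sys'] i by simp
    also have "(A * D) *\<^sub>v w i = A *\<^sub>v (D *\<^sub>v w i)" using A D wi by simp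
    finally have t2: "(t i)\<^sup>2 = (A *\<^sub>v (D *\<^sub>v w i)) \<bullet> (A *\<^sub>v (D *\<^sub>v w i))" .
    have "(a * p)\<^sup>2 \<le> a\<^sup>2 * ((D *\<^sub>v w i) \<bullet> (D *\<^sub>v w i))"
      using p(2)[OF wi(1)] wi(2) by (simp add: power_mult_distrib mult_left_mono)
    also have "\<dots> \<le> (t i)\<^sup>2"
      unfolding t2 a_def by (rule A.form_between_extreme_values(2)[OF sys Dw ne(1)])
    finally show "a * p \<le> t i" using AD.sys_value_nonneg[OF sys'] i by (auto intro: power2_le_imp_le)
    have "(t i)\<^sup>2 \<le> b\<^sup>2 * ((D *\<^sub>v w i) \<bullet> (D *\<^sub>v w i))"
      unfolding t2 b_def by (rule A.form_between_extreme_values(1)[OF sys Dw])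
    also have "\<dots> \<le> (b * q)\<^sup>2"
      using q(2)[OF wi(1)] wi(2) by (simp add: power_mult_distrib mult_left_mono)
    finally show "t i \<le> b * q"
      using q(1) a \<open>a \<le> b\<close> by (auto intro: power2_le_imp_le)
  qed
  have Min: "a * p \<le> Min (t ` {..<n'})" and Max: "Max (t ` {..<n'}) \<le> b * q"
    using ne(2) t by auto
  have MinMax: "Min (t ` {..<n'}) \<le> Max (t ` {..<n'})"
    using ne(2) by (intro Min_le_iff[THEN iffD2]) auto
  have ap: "0 < a * p" using a p(1) by simp
  have cond: "mat_cond (A * D) = Max (t ` {..<n'}) / Min (t ` {..<n'})"
    using AD.condition_number_eq[OF sys'] D by (simp add: mat_cond_def)
  show "0 \<le> mat_cond (A * D)" unfolding cond using ap Min MinMax by simp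
  have "mat_cond (A * D) \<le> (b * q) / (a * p)"
    unfolding cond by (rule frac_le) (use ap Min Max MinMax in auto)
  also have "\<dots> = mat_cond A * (q / p)"
    using A.condition_number_eq[OF sys] A by (simp add: mat_cond_def a_def b_def)
  finally show "mat_cond (A * D) \<le> mat_cond A * (q / p)" .
qed

section \<open>The circular limited-view operator\<close>

lemma index_D_mat_mult_vec:
  assumes x: "x \<in> carrier_vec (2 * K)" and i: "i < 2 * K"
  shows "(D_mat K \<rho> *\<^sub>v x) $ i = 1 / (2 * pi * (real (i div 2 + 1) * \<rho> ^ (i div 2 + 1))) * x $ i"
proof -
  have "(D_mat K \<rho> *\<^sub>v x) $ i = (\<Sum>j<2 * K. D_mat K \<rho> $$ (i, j) * x $ j)"
    using x i by (simp add: D_mat_def scalar_prod_def atLeast0LessThan)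
  also have "\<dots> = (\<Sum>j<2 * K. if j = i
      then 1 / (2 * pi * (real (i div 2 + 1) * \<rho> ^ (i div 2 + 1))) * x $ i else 0)"
    by (rule sum.cong) (use i in \<open>auto simp: D_mat_def Let_def\<close>)
  finally show ?thesis using i by simp
qed

lemma D_mat_bounds:
  assumes K: "K \<ge> 1" and \<rho>: "\<rho> > 1" and x: "x \<in> carrier_vec (2 * K)"
  shows "(1 / (2 * pi * (real K * \<rho> ^ K)))\<^sup>2 * (x \<bullet> x) \<le> (D_mat K \<rho> *\<^sub>v x) \<bullet> (D_mat K \<rho> *\<^sub>v x)"
    and "(D_mat K \<rho> *\<^sub>v x) \<bullet> (D_mat K \<rho> *\<^sub>v x) \<le> (1 / (2 * pi * \<rho>))\<^sup>2 * (x \<bullet> x)"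
proof -
  define d where "d i = 1 / (2 * pi * (real (i div 2 + 1) * \<rho> ^ (i div 2 + 1)))" for i
  have Dx: "(D_mat K \<rho> *\<^sub>v x) \<bullet> (D_mat K \<rho> *\<^sub>v x) = (\<Sum>i<2 * K. (d i)\<^sup>2 * (x $ i)\<^sup>2)"
  proof -
    have "(D_mat K \<rho> *\<^sub>v x) \<bullet> (D_mat K \<rho> *\<^sub>v x) =
        (\<Sum>i<2 * K. (D_mat K \<rho> *\<^sub>v x) $ i * (D_mat K \<rho> *\<^sub>v x) $ i)"
      by (simp add: scalar_prod_def D_mat_def atLeast0LessThan)
    also have "\<dots> = (\<Sum>i<2 * K. (d i)\<^sup>2 * (x $ i)\<^sup>2)"
      by (rule sum.cong) (auto simp: index_D_mat_mult_vec[OF x] d_def power2_eq_square)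
    finally show ?thesis .
  qed
  have xx: "x \<bullet> x = (\<Sum>i<2 * K. (x $ i)\<^sup>2)"
    using x by (simp add: scalar_prod_def atLeast0LessThan power2_eq_square)
  have low: "1 / (2 * pi * (real K * \<rho> ^ K)) \<le> d i" and high: "d i \<le> 1 / (2 * pi * \<rho>)"
    and pos: "0 \<le> d i" if "i < 2 * K" for i
  proof -
    have iK: "i div 2 + 1 \<le> K" using that by auto
    have "real (i div 2 + 1) * \<rho> ^ (i div 2 + 1) \<le> real K * \<rho> ^ K"
      using iK \<rho> by (intro mult_mono power_increasing) auto
    then show "1 / (2 * pi * (real K * \<rho> ^ K)) \<le> d i"
      unfolding d_def using \<rho> by (intro divide_left_mono mult_left_mono mult_pos_pos) (use K in auto)
    have "1 * \<rho> ^ 1 \<le> real (i div 2 + 1) * \<rho> ^ (i div 2 + 1)"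
      using \<rho> by (intro mult_mono power_increasing) auto
    then have "\<rho> \<le> real (i div 2 + 1) * \<rho> ^ (i div 2 + 1)" by simp
    then show "d i \<le> 1 / (2 * pi * \<rho>)"
      unfolding d_def using \<rho> by (intro divide_left_mono mult_left_mono mult_pos_pos) auto
    show "0 \<le> d i" unfolding d_def using \<rho> by simp
  qed
  show "(1 / (2 * pi * (real K * \<rho> ^ K)))\<^sup>2 * (x \<bullet> x) \<le> (D_mat K \<rho> *\<^sub>v x) \<bullet> (D_mat K \<rho> *\<^sub>v x)"
    unfolding Dx xx sum_distrib_left
    by (intro sum_mono mult_right_mono power_mono) (use low \<rho> in auto)
  show "(D_mat K \<rho> *\<^sub>v x) \<bullet> (D_mat K \<rho> *\<^sub>v x) \<le> (1 / (2 * pi * \<rho>))\<^sup>2 * (x \<bullet> x)"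
    unfolding Dx xx sum_distrib_left
    by (intro sum_mono mult_right_mono power_mono) (use high pos in auto)
qed

lemma transpose_D_mat: "transpose_mat (D_mat K \<rho>) = D_mat K \<rho>"
  by (rule eq_matI) (auto simp: D_mat_def Let_def)

lemma D_mat_carrier: "D_mat K \<rho> \<in> carrier_mat (2 * K) (2 * K)"
  by (simp add: D_mat_def)

lemma L_op_eq_conjugation:
  assumes C: "C \<in> carrier_mat N n" and D: "D \<in> carrier_mat n n" "transpose_mat D = D"
    and X: "X \<in> carrier_mat n n"
  shows "L_op C D X = (C * D) * X * transpose_mat (C * D)"
proof -
  have "transpose_mat (C * D) = D * transpose_mat C"
    using transpose_mult[OF C D(1)] D(2) by simp
  moreover have "C * D * X * (D * transpose_mat C) = C * D * X * D * transpose_mat C"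
    using C D X by (subst assoc_mult_mat[of _ N n _ n _ N, symmetric]) auto
  ultimately show ?thesis by (simp add: L_op_def)
qed

theorem proposition4p1:
  fixes K N :: nat and \<rho> \<gamma> :: real and \<theta> \<mu> :: "nat \<Rightarrow> real" and C D G :: "real mat"
  assumes "K \<ge> 1" and "N \<ge> 2 * K"
    and "\<rho> > 1" and "0 < \<gamma>" and "\<gamma> < 2 * pi"
    and "\<And>s. s \<in> {1..N} \<Longrightarrow> \<theta> s = \<gamma> * real s / real N"
    and "C = C_mat N K \<theta>" and "D = D_mat K \<rho>"
    and "maximal_rank C"
    and "G = D * transpose_mat C * C * D"
    and "\<And>n. n \<in> {1..2 * K} \<Longrightarrow> \<mu> n = nth_largest_eigenvalue G n"
  shows "(\<forall>v. orthonormal_basis (carrier_vec (2 * K)) scalar_prod {1..2 * K} v \<and>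
              (\<forall>n\<in>{1..2 * K}. eigenvector G (v n) (\<mu> n)) \<longrightarrow>
            singular_system (carrier_mat (2 * K) (2 * K)) frob_inner frob_inner (L_op C D)
              ({1..2 * K} \<times> {1..2 * K})
              (\<lambda>(a, b). outer_prod (v a) (v b))
              (\<lambda>(a, b). sqrt (\<mu> a * \<mu> b)))
         \<and> op_cond (2 * K) (L_op C D) = mat_cond G
         \<and> mat_cond G \<le> (mat_cond C)\<^sup>2 * (real K)\<^sup>2 * \<rho> ^ (2 * (K - 1))"
proof (intro conjI allI impI)
  let ?n = "2 * K"
  have n: "?n \<noteq> 0" using assms(1) by simp
  have C: "C \<in> carrier_mat N ?n" by (simp add: assms(7) C_mat_def)
  have D: "D \<in> carrier_mat ?n ?n" "transpose_mat D = D"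
    by (simp_all add: assms(8) D_mat_carrier transpose_D_mat)
  have A: "C * D \<in> carrier_mat N ?n" using C D by simp
  have G: "G = transpose_mat (C * D) * (C * D)"
    using C D transpose_mult[OF C D(1)] unfolding assms(10)
    by (simp add: assoc_mult_mat[of _ ?n N _ ?n _ ?n] assoc_mult_mat[of _ ?n ?n _ N _ ?n]
        assoc_mult_mat[of _ ?n ?n _ ?n _ ?n])
  note L = L_op_eq_conjugation[OF C D]
  {
    fix v
    assume "orthonormal_basis (carrier_vec ?n) scalar_prod {1..?n} v \<and>
      (\<forall>n\<in>{1..?n}. eigenvector G (v n) (\<mu> n))"
    then have v: "orthonormal_basis (carrier_vec ?n) scalar_prod {1..?n} v"
      and ev: "\<And>n. n \<in> {1..?n} \<Longrightarrow> eigenvector G (v n) (\<mu> n)" by blast+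
    have "((C * D) *\<^sub>v v i) \<bullet> ((C * D) *\<^sub>v v j) = (if i = j then \<mu> i else 0)"
      if ij: "i \<in> {1..?n}" "j \<in> {1..?n}" for i j
    proof -
      have vV: "v i \<in> carrier_vec ?n" "v j \<in> carrier_vec ?n"
        and on: "v i \<bullet> v j = (if i = j then 1 else 0)"
        using v ij unfolding orthonormal_basis_def by blast+
      have "((C * D) *\<^sub>v v i) \<bullet> ((C * D) *\<^sub>v v j) = v i \<bullet> (G *\<^sub>v v j)"
        unfolding G by (rule gram_form[OF A vV, symmetric])
      also have "G *\<^sub>v v j = \<mu> j \<cdot>\<^sub>v v j" using ev[OF ij(2)] unfolding eigenvector_def by blast
      also have "v i \<bullet> (\<mu> j \<cdot>\<^sub>v v j) = \<mu> j * (v i \<bullet> v j)" using vV by simp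
      finally show ?thesis using on by simp
    qed
    then have "singular_system (carrier_mat ?n ?n) frob_inner frob_inner
        (\<lambda>X. (C * D) * X * transpose_mat (C * D)) ({1..?n} \<times> {1..?n})
        (\<lambda>(a, b). outer_prod (v a) (v b)) (\<lambda>(a, b). sqrt (\<mu> a * \<mu> b))"
      by (rule outer_prod_singular_system[OF A v])
    then show "singular_system (carrier_mat ?n ?n) frob_inner frob_inner (L_op C D)
        ({1..?n} \<times> {1..?n}) (\<lambda>(a, b). outer_prod (v a) (v b)) (\<lambda>(a, b). sqrt (\<mu> a * \<mu> b))"
      by (subst singular_system_cong[OF L])
  }
  have condG: "mat_cond G = (mat_cond (C * D))\<^sup>2"
    unfolding G by (rule mat_cond_gram[OF A n])
  have "op_cond ?n (L_op C D) = op_cond ?n (\<lambda>X. (C * D) * X * transpose_mat (C * D))"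
    unfolding op_cond_def by (rule condition_number_cong[OF L])
  then show "op_cond ?n (L_op C D) = mat_cond G"
    using conjugation_cond[OF A n] condG by simp
  have "vec_space.rank N C = ?n"
    using assms(2,9) C unfolding maximal_rank_def by simp
  then have inj: "x = 0\<^sub>v ?n" if "x \<in> carrier_vec ?n" "C *\<^sub>v x = 0\<^sub>v N" for x
    using full_column_rank_injective[OF C] that by blast
  have \<rho>: "\<rho> > 0" using assms(3) by simp
  note cond = mat_cond_mult_le[OF C D(1) n inj, of "1 / (2 * pi * (real K * \<rho> ^ K))" "1 / (2 * pi * \<rho>)"]
  have D_low: "(1 / (2 * pi * (real K * \<rho> ^ K)))\<^sup>2 * (x \<bullet> x) \<le> (D *\<^sub>v x) \<bullet> (D *\<^sub>v x)"
    and D_high: "(D *\<^sub>v x) \<bullet> (D *\<^sub>v x) \<le> (1 / (2 * pi * \<rho>))\<^sup>2 * (x \<bullet> x)"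
    if "x \<in> carrier_vec ?n" for x
    using D_mat_bounds[OF assms(1,3) that] by (simp_all add: assms(8))
  have p: "0 < 1 / (2 * pi * (real K * \<rho> ^ K))" and q: "0 \<le> 1 / (2 * pi * \<rho>)"
    using assms(1) \<rho> by simp_all
  have ratio: "(1 / (2 * pi * \<rho>)) / (1 / (2 * pi * (real K * \<rho> ^ K))) = real K * \<rho> ^ (K - 1)"
    using \<rho> assms(1) by (cases K) (auto simp: field_simps)
  have "mat_cond G \<le> (mat_cond C * (real K * \<rho> ^ (K - 1)))\<^sup>2"
    unfolding condG using cond[OF _ _ p D_low q D_high] unfolding ratio
    by (intro power_mono) auto
  then show "mat_cond G \<le> (mat_cond C)\<^sup>2 * (real K)\<^sup>2 * \<rho> ^ (2 * (K - 1))"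
    by (simp add: power_mult_distrib power_mult mult.commute[of 2] mult.assoc)
qed

end
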